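(* Let $\Omega\subset\mathbb{R}^N$ be a bounded domain with Lipschitz boundary, let $1<q<p<N$, let $T:W_0^{1,p}(\Omega)\to W^{1,p}(\Omega)$ be a continuous map, let $f:\Omega\times\mathbb{R}\times\mathbb{R}^N\to\mathbb{R}$ be a Carathéodory function, and let $\{X_n\}_{n\in\mathbb{N}}$ be a Galerkin basis of $W_0^{1,p}(\Omega)$. Assume: (1) There exist constants $a_1\ge 0$, $a_2\ge 0$, $\alpha\in(0,p^*-1)$, $\beta\in\left(0,\frac{p}{(p^* )'}\right)$ and a function $\sigma\in L^{r'}(\Omega)$ with $r\in[1,p^* )$ such that $|f(x,s,\xi)|\le \sigma(x)+a_1|s|^\alpha+a_2|\xi|^\beta$ for almost all $x\in\Omega$, all $s\in\mathbb{R}$ and all $\xi\in\mathbb{R}^N$. (2) There exist constants $K_1,K_2,K_3\ge 0$ with $a_1K_1S_{\frac{p^*}{p^*-\alpha}}+a_2K_2S_{\frac{p}{p-\beta}}<1$ such that $\|T(u)\|_{p^*}^\alpha\le K_1\|\nabla u\|_p^{p-1}+K_3$ and $\|\nabla T(u)\|_p^\beta\le K_2\|\nabla u\|_p^{p-1}+K_3$ for all $u\in W_0^{1,p}(\Omega)$. Then for each $n\in\mathbb{N}$ there exists $u_n\in X_n$ such that $$\langle-\Delta_p u_n+\Delta_q u_n,v\rangle=\int_\Omega f(x,T(u_n),\nabla T(u_n))\,v\,dx\quad\text{for all }v\in X_n.$$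
   Context: For $r\in(1,+\infty)$, $r'=r/(r-1)$ (and $r'=\infty$ if $r=1$). $p^*=\frac{Np}{N-p}$. $\|\cdot\|_r$ is the norm of $L^r(\Omega)$, and $W_0^{1,p}(\Omega)$ carries the norm $\|u\|=\|\nabla u\|_p$. For $1\le r\le p^*$, $S_r$ denotes a positive constant such that $\|u\|_r\le S_r\|\nabla u\|_p$ for all $u\in W_0^{1,p}(\Omega)$ (Sobolev embedding constant). A Carathéodory function $f(x,s,\xi)$ is measurable in $x$ and continuous in $(s,\xi)$. The operators are $\langle-\Delta_p u,v\rangle=\int_\Omega|\nabla u|^{p-2}\nabla u\cdot\nabla v\,dx$ and $\langle\Delta_q u,v\rangle=-\int_\Omega|\nabla u|^{q-2}\nabla u\cdot\nabla v\,dx$, for $u,v\in W_0^{1,p}(\Omega)$. A Galerkin basis of $W_0^{1,p}(\Omega)$ is a sequence $\{X_n\}_{n\in\mathbb{N}}$ of vector subspaces of $W_0^{1,p}(\Omega)$ with $\dim(X_n)<\infty$ and $X_n\subset X_{n+1}$ for all $n$, and $\overline{\bigcup_{n=1}^\infty X_n}=W_0^{1,p}(\Omega)$. *)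

theory Defs
  imports "HOL-Analysis.Analysis"
begin

text \<open>
  Elements of Lebesgue and Sobolev spaces are represented by functions; two functions that
  agree almost everywhere on \<open>\<Omega>\<close> represent the same element.  Only the values on \<open>\<Omega>\<close> matter.
\<close>

section \<open>Lipschitz domains\<close>

definition bounded_domain :: "'a::euclidean_space set \<Rightarrow> bool" where
  "bounded_domain \<Omega> \<longleftrightarrow> open \<Omega> \<and> connected \<Omega> \<and> \<Omega> \<noteq> {} \<and> bounded \<Omega>"

text \<open>
  Near each boundary point, \<open>\<Omega>\<close> is the strict epigraph, in some direction \<open>e\<close>, of a Lipschitz
  function \<open>\<gamma>\<close> on the hyperplane orthogonal to \<open>e\<close>.
\<close>

definition lipschitz_boundary :: "'a::euclidean_space set \<Rightarrow> bool" where
  "lipschitz_boundary \<Omega> \<longleftrightarrow>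
     (\<forall>z\<in>frontier \<Omega>. \<exists>\<rho>>0. \<exists>e L. \<exists>\<gamma>::'a \<Rightarrow> real.
        norm e = 1 \<and> L-lipschitz_on {y. y \<bullet> e = 0} \<gamma> \<and>
        \<Omega> \<inter> ball z \<rho> = {x \<in> ball z \<rho>. \<gamma> (x - (x \<bullet> e) *\<^sub>R e) < x \<bullet> e})"

section \<open>Lebesgue spaces\<close>

text \<open>Powers of extended nonnegative reals; used with positive exponents only.\<close>

definition epowr :: "ennreal \<Rightarrow> real \<Rightarrow> ennreal" where
  "epowr x a = (if x = \<infinity> then \<infinity> else ennreal (enn2real x powr a))"

text \<open>The norm takes the value \<open>\<infinity>\<close> on measurable functions that do not lie in the space.\<close>

definition Lnorm :: "'a::euclidean_space set \<Rightarrow> ereal \<Rightarrow> ('a \<Rightarrow> 'b::real_normed_vector) \<Rightarrow> ennreal" where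
  "Lnorm \<Omega> r u =
     (if r = \<infinity> then Inf {C. AE x in lebesgue_on \<Omega>. ennreal (norm (u x)) \<le> C}
      else epowr (\<integral>\<^sup>+x. ennreal (norm (u x) powr real_of_ereal r) \<partial>lebesgue_on \<Omega>)
                 (1 / real_of_ereal r))"

definition Lspace :: "'a::euclidean_space set \<Rightarrow> ereal \<Rightarrow> ('a \<Rightarrow> 'b::real_normed_vector) set" where
  "Lspace \<Omega> r = {u \<in> borel_measurable (lebesgue_on \<Omega>). Lnorm \<Omega> r u < \<infinity>}"

definition conj_exponent :: "real \<Rightarrow> ereal" where
  "conj_exponent r = (if r = 1 then \<infinity> else ereal (r / (r - 1)))"

section \<open>Weak gradients and Sobolev spaces\<close>

text \<open>\<open>Ck k\<close>: all iterated partial derivatives up to order \<open>k\<close> exist and are continuous.\<close>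

fun Ck :: "nat \<Rightarrow> ('a::euclidean_space \<Rightarrow> real) \<Rightarrow> bool" where
  "Ck 0 \<phi> \<longleftrightarrow> continuous_on UNIV \<phi>"
| "Ck (Suc k) \<phi> \<longleftrightarrow>
     (\<forall>x. \<phi> differentiable (at x)) \<and> (\<forall>i\<in>Basis. Ck k (\<lambda>x. frechet_derivative \<phi> (at x) i))"

definition test_functions :: "'a::euclidean_space set \<Rightarrow> ('a \<Rightarrow> real) set" where
  "test_functions \<Omega> =
     {\<phi>. (\<forall>k. Ck k \<phi>) \<and> compact (closure {x. \<phi> x \<noteq> 0}) \<and> closure {x. \<phi> x \<noteq> 0} \<subseteq> \<Omega>}"

definition locally_integrable ::
    "'a::euclidean_space set \<Rightarrow> ('a \<Rightarrow> 'b::{banach, second_countable_topology}) \<Rightarrow> bool" where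
  "locally_integrable \<Omega> u \<longleftrightarrow> (\<forall>K. compact K \<and> K \<subseteq> \<Omega> \<longrightarrow> integrable (lebesgue_on K) u)"

definition weak_gradient ::
    "'a::euclidean_space set \<Rightarrow> ('a \<Rightarrow> real) \<Rightarrow> ('a \<Rightarrow> 'a) \<Rightarrow> bool" where
  "weak_gradient \<Omega> u g \<longleftrightarrow>
     locally_integrable \<Omega> u \<and> locally_integrable \<Omega> g \<and>
     (\<forall>\<phi>\<in>test_functions \<Omega>. \<forall>i\<in>Basis.
        (LINT x|lebesgue_on \<Omega>. u x * frechet_derivative \<phi> (at x) i)
        = - (LINT x|lebesgue_on \<Omega>. (g x \<bullet> i) * \<phi> x))"

text \<open>On an open set the weak gradient is unique up to null sets; \<open>grad\<close> picks a representative.\<close>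

definition grad :: "'a::euclidean_space set \<Rightarrow> ('a \<Rightarrow> real) \<Rightarrow> 'a \<Rightarrow> 'a" where
  "grad \<Omega> u = (SOME g. weak_gradient \<Omega> u g)"

definition sobolev :: "'a::euclidean_space set \<Rightarrow> real \<Rightarrow> ('a \<Rightarrow> real) set" where
  "sobolev \<Omega> p = {u \<in> Lspace \<Omega> p. \<exists>g\<in>Lspace \<Omega> p. weak_gradient \<Omega> u g}"

definition sobolev_norm :: "'a::euclidean_space set \<Rightarrow> real \<Rightarrow> ('a \<Rightarrow> real) \<Rightarrow> ennreal" where
  "sobolev_norm \<Omega> p u = Lnorm \<Omega> p u + Lnorm \<Omega> p (grad \<Omega> u)"

definition sobolev0 :: "'a::euclidean_space set \<Rightarrow> real \<Rightarrow> ('a \<Rightarrow> real) set" where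
  "sobolev0 \<Omega> p =
     {u \<in> sobolev \<Omega> p. \<forall>\<epsilon>>0. \<exists>\<phi>\<in>test_functions \<Omega>. sobolev_norm \<Omega> p (\<lambda>x. u x - \<phi> x) < \<epsilon>}"

definition sobolev0_norm :: "'a::euclidean_space set \<Rightarrow> real \<Rightarrow> ('a \<Rightarrow> real) \<Rightarrow> ennreal" where
  "sobolev0_norm \<Omega> p u = Lnorm \<Omega> p (grad \<Omega> u)"

text \<open>
  Continuity with respect to the norms forces \<open>T\<close> to respect equality almost everywhere, so this
  describes exactly the continuous maps between the spaces of equivalence classes.
\<close>

definition continuous_sobolev_map ::
    "'a::euclidean_space set \<Rightarrow> real \<Rightarrow> (('a \<Rightarrow> real) \<Rightarrow> ('a \<Rightarrow> real)) \<Rightarrow> bool" where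
  "continuous_sobolev_map \<Omega> p T \<longleftrightarrow>
     (\<forall>u\<in>sobolev0 \<Omega> p. T u \<in> sobolev \<Omega> p) \<and>
     (\<forall>u\<in>sobolev0 \<Omega> p. \<forall>\<epsilon>>0. \<exists>\<delta>>0. \<forall>w\<in>sobolev0 \<Omega> p.
        sobolev0_norm \<Omega> p (\<lambda>x. w x - u x) < \<delta> \<longrightarrow>
        sobolev_norm \<Omega> p (\<lambda>x. T w x - T u x) < \<epsilon>)"

definition sobolev_constants :: "'a::euclidean_space set \<Rightarrow> real \<Rightarrow> real \<Rightarrow> (real \<Rightarrow> real) \<Rightarrow> bool" where
  "sobolev_constants \<Omega> p pstar S \<longleftrightarrow>
     (\<forall>r\<in>{1..pstar}. S r > 0 \<and>
        (\<forall>u\<in>sobolev0 \<Omega> p. Lnorm \<Omega> r u \<le> ennreal (S r) * Lnorm \<Omega> p (grad \<Omega> u)))"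

section \<open>Galerkin bases\<close>

definition function_subspace :: "('a \<Rightarrow> real) set \<Rightarrow> bool" where
  "function_subspace X \<longleftrightarrow>
     (\<lambda>x. 0) \<in> X \<and> (\<forall>u\<in>X. \<forall>v\<in>X. (\<lambda>x. u x + v x) \<in> X) \<and> (\<forall>c. \<forall>u\<in>X. (\<lambda>x. c * u x) \<in> X)"

text \<open>Finite dimension modulo equality almost everywhere.\<close>

definition finite_dimensional_ae :: "'a::euclidean_space set \<Rightarrow> ('a \<Rightarrow> real) set \<Rightarrow> bool" where
  "finite_dimensional_ae \<Omega> X \<longleftrightarrow>
     (\<exists>B. finite B \<and> B \<subseteq> X \<and>
        (\<forall>u\<in>X. \<exists>c. AE x in lebesgue_on \<Omega>. u x = (\<Sum>b\<in>B. c b * b x)))"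

definition galerkin_basis ::
    "'a::euclidean_space set \<Rightarrow> real \<Rightarrow> (nat \<Rightarrow> ('a \<Rightarrow> real) set) \<Rightarrow> bool" where
  "galerkin_basis \<Omega> p X \<longleftrightarrow>
     (\<forall>n. X n \<subseteq> sobolev0 \<Omega> p \<and> function_subspace (X n) \<and> finite_dimensional_ae \<Omega> (X n)
          \<and> X n \<subseteq> X (Suc n)) \<and>
     (\<forall>u\<in>sobolev0 \<Omega> p. \<forall>\<epsilon>>0. \<exists>w\<in>(\<Union>n. X n). sobolev0_norm \<Omega> p (\<lambda>x. u x - w x) < \<epsilon>)"

section \<open>Nonlinearities and operators\<close>

definition caratheodory ::
    "'a::euclidean_space set \<Rightarrow> ('a \<Rightarrow> real \<Rightarrow> 'a \<Rightarrow> real) \<Rightarrow> bool" where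
  "caratheodory \<Omega> f \<longleftrightarrow>
     (\<forall>s \<xi>. (\<lambda>x. f x s \<xi>) \<in> borel_measurable (lebesgue_on \<Omega>)) \<and>
     (AE x in lebesgue_on \<Omega>. continuous_on UNIV (\<lambda>(s, \<xi>). f x s \<xi>))"

text \<open>The duality pairing of the \<open>r\<close>-Laplacian of \<open>u\<close> with \<open>v\<close>.\<close>

definition laplacian_pairing ::
    "'a::euclidean_space set \<Rightarrow> real \<Rightarrow> ('a \<Rightarrow> real) \<Rightarrow> ('a \<Rightarrow> real) \<Rightarrow> real" where
  "laplacian_pairing \<Omega> r u v =
     - (LINT x|lebesgue_on \<Omega>. norm (grad \<Omega> u x) powr (r - 2) * (grad \<Omega> u x \<bullet> grad \<Omega> v x))"

end

theory Submission
  imports Defs "HOL-Computational_Algebra.Polynomial"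
begin

text \<open>
  On \<open>X n\<close> the equation is a finite system in the coefficients.  A coercive continuous map of a
  cube has a zero (Kuhn's lemma, i.e. Brouwer's theorem), so it remains to check coercivity and
  continuity.  By Hoelder and the Sobolev embedding the reaction term tested with \<open>u\<close> is at most
  \<open>\<kappa> * \<parallel>\<nabla>u\<parallel>^p + C * \<parallel>\<nabla>u\<parallel>\<close> with \<open>\<kappa> < 1\<close>, and the \<open>q\<close>-energy is of lower order, so the
  \<open>p\<close>-energy dominates.  Continuity of the reaction term follows from Vitali's theorem: along
  subsequences \<open>T u\<close> and its gradient converge almost everywhere, and as the growth exponents are
  subcritical the integrands are uniformly integrable.
\<close>

section \<open>Zeros of coercive maps\<close>

text \<open>Elements of the spaces are functions modulo null sets, and this shapes the development.
  \<open>grad\<close> is a chosen representative, so even its additivity holds only almost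
  everywhere and rests on the uniqueness of weak gradients, hence on the fundamental lemma and on
  explicit test functions. For combinations of basis functions the chosen gradient is replaced by
  one that is linear in the coefficients at every point. The hypotheses dictate the exponents. The
  conjugates of p*/\<alpha> and p/\<beta> are p*/(p*-\<alpha>) and p/(p-\<beta>); the upper bounds
  on \<alpha> and \<beta> put them below p*, where the embedding of the test function is available.
  The power p-1 in the bounds for T gives the reaction term, tested with u itself, the degree p of
  the energy, so the two compete through their coefficients, and the gap 1-\<kappa> has to pay for
  everything of lower order. In the continuity proof the test function is fixed: over a small set
  its norms are small while the factors with T u stay bounded, which is the source of uniform
  integrability.\<close>

lemma tendsto_fun_iff:
  fixes f :: "'b \<Rightarrow> 'i \<Rightarrow> 'a::topological_space"
  shows "(f \<longlongrightarrow> l) F \<longleftrightarrow> (\<forall>i. ((\<lambda>n. f n i) \<longlongrightarrow> l i) F)"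
proof -
  have "(f \<longlongrightarrow> l) F \<longleftrightarrow> limitin (product_topology (\<lambda>i. euclidean) UNIV) f l F"
    by (simp add: euclidean_product_topology)
  also have "\<dots> \<longleftrightarrow> (\<forall>i. ((\<lambda>n. f n i) \<longlongrightarrow> l i) F)"
    by (subst limitin_componentwise) (auto simp: )
  finally show ?thesis .
qed

text \<open>Coordinates from n on are pinned to 0, so that a subset of an infinite product is
  compact and has exactly n free coordinates.\<close>

definition coord_cube :: "nat \<Rightarrow> real \<Rightarrow> (nat \<Rightarrow> real) set" where
  "coord_cube n M = {x. (\<forall>j<n. \<bar>x j\<bar> \<le> M) \<and> (\<forall>j\<ge>n. x j = 0)}"

lemma compact_coord_cube: "compact (coord_cube n M)"
proof -
  let ?S = "\<lambda>j. if j < n then {-M..M} else {0}"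
  have "x j \<in> ?S j \<longleftrightarrow> (j < n \<longrightarrow> \<bar>x j\<bar> \<le> M) \<and> (n \<le> j \<longrightarrow> x j = 0)" for x j
    by (auto simp: abs_le_iff minus_le_iff)
  then have "coord_cube n M = PiE UNIV ?S"
    by (simp add: set_eq_iff coord_cube_def PiE_UNIV_domain Pi_iff) blast
  moreover have "compactin (product_topology (\<lambda>i. euclidean) UNIV) (PiE UNIV ?S)"
    by (subst compactin_PiE) auto
  ultimately show ?thesis
    by (simp add: euclidean_product_topology)
qed

text \<open>Grid points are labelled, coordinate by coordinate, by the sign of A. Kuhn's lemma finds
  a cell in which every coordinate meets both labels; c is the lower corner of that cell. The points
  r and s depend on i, and only their distance to c, at most one mesh width, is controlled.\<close>

lemma kuhn_cube_approximate_zero: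
  fixes A :: "(nat \<Rightarrow> real) \<Rightarrow> nat \<Rightarrow> real"
  assumes "0 < M" "0 < m"
  shows "\<exists>c\<in>coord_cube n M. \<forall>i<n. \<exists>r\<in>coord_cube n M. \<exists>s\<in>coord_cube n M.
       (\<forall>j. \<bar>r j - c j\<bar> \<le> 2 * M / real m) \<and> (\<forall>j. \<bar>s j - c j\<bar> \<le> 2 * M / real m) \<and>
       (r i = - M \<or> A r i \<le> 0) \<and> (s i = M \<or> 0 \<le> A s i)"
proof -
  define P :: "(nat \<Rightarrow> nat) \<Rightarrow> nat \<Rightarrow> real"
    where "P q = (\<lambda>j. if j < n then 2 * M * real (q j) / real m - M else 0)" for q
  \<comment> \<open>Kuhn's lemma requires label 0 on the lower faces and label 1 on the upper ones.
    Forcing these values is what brings in the alternatives \<open>r i = - M\<close> and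
    \<open>s i = M\<close>.\<close>
  define label where
    "label q i = (if q i = 0 then 0 else if q i = m then 1 else if A (P q) i \<le> 0 then 0 else 1::nat)" for q i
  obtain q where q: "\<forall>i<n. q i < m"
    and lab: "\<forall>i<n. \<exists>r s. (\<forall>j<n. q j \<le> r j \<and> r j \<le> q j + 1) \<and>
        (\<forall>j<n. q j \<le> s j \<and> s j \<le> q j + 1) \<and> label r i \<noteq> label s i"
    by (rule kuhn_lemma[of m n label]) (use assms in \<open>auto simp: label_def\<close>)
  have P_cube: "P r \<in> coord_cube n M" if "\<forall>j<n. r j \<le> m" for r
  proof -
    have "2 * M * real (r j) / real m \<le> 2 * M" if "j < n" for j
    proof -
      have "real (r j) / real m \<le> 1"
        using \<open>\<forall>j<n. r j \<le> m\<close> that assms by simp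
      from mult_left_mono[OF this, of "2 * M"] show ?thesis
        using assms by simp
    qed
    moreover have "2 * M * real (r j) / real m \<ge> 0" for j
      using assms by simp
    ultimately show ?thesis
      by (force simp: coord_cube_def P_def abs_le_iff)
  qed
  have P_near: "\<bar>P r j - P q j\<bar> \<le> 2 * M / real m" if "\<forall>j<n. q j \<le> r j \<and> r j \<le> q j + 1" for r j
  proof (cases "j < n")
    case True
    then have "\<bar>real (r j) - real (q j)\<bar> \<le> 1"
      using that by fastforce
    moreover have "P r j - P q j = (2 * M / real m) * (real (r j) - real (q j))"
      using True by (simp add: P_def algebra_simps diff_divide_distrib)
    ultimately show ?thesis
      using assms mult_left_mono[of "\<bar>real (r j) - real (q j)\<bar>" 1 "2 * M / real m"]
      by (simp add: abs_mult)
  qed (use assms in \<open>simp add: P_def\<close>)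
  show ?thesis
  proof (rule bexI[of _ "P q"], intro allI impI)
    show "P q \<in> coord_cube n M"
      using q by (intro P_cube) (auto simp: less_imp_le)
    fix i assume i: "i < n"
    obtain r s where rs: "\<forall>j<n. q j \<le> r j \<and> r j \<le> q j + 1" "\<forall>j<n. q j \<le> s j \<and> s j \<le> q j + 1"
      "label r i = 0" "label s i = 1"
    proof -
      obtain r s where "\<forall>j<n. q j \<le> r j \<and> r j \<le> q j + 1" "\<forall>j<n. q j \<le> s j \<and> s j \<le> q j + 1"
        "label r i \<noteq> label s i"
        using lab i by blast
      moreover have "label r i = 0 \<or> label r i = 1" "label s i = 0 \<or> label s i = 1"
        by (auto simp: label_def)
      ultimately show ?thesis
        using that by metis
    qed
    have "r j \<le> m" "s j \<le> m" if "j < n" for j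
      using rs(1,2) q that by (metis Suc_eq_plus1 Suc_leI le_trans)+
    then have "P r \<in> coord_cube n M" "P s \<in> coord_cube n M"
      by (auto intro!: P_cube)
    moreover have "P r i = - M \<or> A (P r) i \<le> 0"
      using rs(3) i by (auto simp: label_def P_def split: if_splits)
    moreover have "P s i = M \<or> 0 \<le> A (P s) i"
      using rs(4) i assms by (auto simp: label_def P_def split: if_splits)
    ultimately show "\<exists>r\<in>coord_cube n M. \<exists>s\<in>coord_cube n M.
       (\<forall>j. \<bar>r j - P q j\<bar> \<le> 2 * M / real m) \<and> (\<forall>j. \<bar>s j - P q j\<bar> \<le> 2 * M / real m) \<and>
       (r i = - M \<or> A r i \<le> 0) \<and> (s i = M \<or> 0 \<le> A s i)"
      using P_near[OF rs(1)] P_near[OF rs(2)] by blast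
  qed
qed

text \<open>
  Kuhn's lemma yields a point \<open>x\<close> of the cube solving the variational inequality of \<open>A\<close>, so that
  \<open>x i * A x i \<le> 0\<close> for every \<open>i\<close>; coercivity then forces \<open>x\<close> into the interior.  Working with
  coordinates indexed by \<open>nat\<close> keeps the dimension a number instead of a type.
\<close>

lemma coercive_zero_in_cube:
  fixes A :: "(nat \<Rightarrow> real) \<Rightarrow> nat \<Rightarrow> real"
  assumes M: "0 < M"
    and cont: "\<And>i. i < n \<Longrightarrow> continuous_on (coord_cube n M) (\<lambda>x. A x i)"
    and coercive: "\<And>x i. \<lbrakk>x \<in> coord_cube n M; i < n; \<bar>x i\<bar> = M\<rbrakk> \<Longrightarrow> 0 < (\<Sum>i<n. x i * A x i)"
  shows "\<exists>x\<in>coord_cube n M. \<forall>i<n. A x i = 0"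
proof -
  let ?K = "coord_cube n M"
  obtain c where cK: "\<And>m. c m \<in> ?K"
    and c: "\<And>m i. i < n \<Longrightarrow> \<exists>r\<in>?K. \<exists>s\<in>?K. (\<forall>j. \<bar>r j - c m j\<bar> \<le> 2 * M / real (Suc m)) \<and>
       (\<forall>j. \<bar>s j - c m j\<bar> \<le> 2 * M / real (Suc m)) \<and>
       (r i = - M \<or> A r i \<le> 0) \<and> (s i = M \<or> 0 \<le> A s i)"
  proof -
    have "\<exists>c\<in>?K. \<forall>i<n. \<exists>r\<in>?K. \<exists>s\<in>?K. (\<forall>j. \<bar>r j - c j\<bar> \<le> 2 * M / real (Suc m)) \<and>
       (\<forall>j. \<bar>s j - c j\<bar> \<le> 2 * M / real (Suc m)) \<and>
       (r i = - M \<or> A r i \<le> 0) \<and> (s i = M \<or> 0 \<le> A s i)" for m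
      using M by (rule kuhn_cube_approximate_zero) simp
    then have "\<forall>m. \<exists>c. c \<in> ?K \<and> (\<forall>i<n. \<exists>r\<in>?K. \<exists>s\<in>?K. (\<forall>j. \<bar>r j - c j\<bar> \<le> 2 * M / real (Suc m)) \<and>
       (\<forall>j. \<bar>s j - c j\<bar> \<le> 2 * M / real (Suc m)) \<and>
       (r i = - M \<or> A r i \<le> 0) \<and> (s i = M \<or> 0 \<le> A s i))"
      by blast
    then show thesis
      unfolding choice_iff using that by blast
  qed
  obtain x g where x: "x \<in> ?K" and g: "strict_mono g" and lim: "(c \<circ> g) \<longlonglongrightarrow> x"
    using compact_coord_cube[of n M] cK unfolding compact_eq_seq_compact_metric seq_compact_def
    by blast
  have near_lim: "y \<longlonglongrightarrow> x" if "\<And>m j. \<bar>y m j - c (g m) j\<bar> \<le> 2 * M / real (Suc (g m))" for y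
    unfolding tendsto_fun_iff
  proof
    fix j
    have "(\<lambda>m. 2 * M * inverse (real (Suc (g m)))) \<longlonglongrightarrow> 2 * M * 0"
      using LIMSEQ_subseq_LIMSEQ[OF LIMSEQ_inverse_real_of_nat g]
      by (intro tendsto_mult tendsto_const) (simp add: o_def)
    then have "(\<lambda>m. 2 * M / real (Suc (g m))) \<longlonglongrightarrow> 0"
      by (simp add: divide_inverse)
    then have "(\<lambda>m. y m j - c (g m) j) \<longlonglongrightarrow> 0"
      by (rule Lim_null_comparison[rotated]) (simp add: that del: of_nat_Suc)
    moreover have "(\<lambda>m. c (g m) j) \<longlonglongrightarrow> x j"
      using lim by (simp add: tendsto_fun_iff o_def)
    ultimately show "(\<lambda>m. y m j) \<longlonglongrightarrow> x j"
      using tendsto_add by force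
  qed
  have closedK: "closed ?K"
    by (simp add: compact_coord_cube compact_imp_closed)
  have coord: "continuous_on ?K (\<lambda>x. x i)" for i
    by (rule continuous_on_subset[OF continuous_on_product_coordinates]) simp
  have alt: "(x i = - M \<or> A x i \<le> 0) \<and> (x i = M \<or> 0 \<le> A x i)" if i: "i < n" for i
  proof -
    have "\<forall>m. \<exists>r s. r \<in> ?K \<and> s \<in> ?K \<and> (\<forall>j. \<bar>r j - c (g m) j\<bar> \<le> 2 * M / real (Suc (g m))) \<and>
       (\<forall>j. \<bar>s j - c (g m) j\<bar> \<le> 2 * M / real (Suc (g m))) \<and>
       (r i = - M \<or> A r i \<le> 0) \<and> (s i = M \<or> 0 \<le> A s i)"
      using c[OF i] by blast
    then have "\<exists>r s. \<forall>m. r m \<in> ?K \<and> s m \<in> ?K \<and> (\<forall>j. \<bar>r m j - c (g m) j\<bar> \<le> 2 * M / real (Suc (g m))) \<and>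
       (\<forall>j. \<bar>s m j - c (g m) j\<bar> \<le> 2 * M / real (Suc (g m))) \<and>
       (r m i = - M \<or> A (r m) i \<le> 0) \<and> (s m i = M \<or> 0 \<le> A (s m) i)"
      by (simp only: choice_iff)
    then obtain r s where rs: "\<And>m. r m \<in> ?K" "\<And>m. s m \<in> ?K"
       "\<And>m j. \<bar>r m j - c (g m) j\<bar> \<le> 2 * M / real (Suc (g m))"
       "\<And>m j. \<bar>s m j - c (g m) j\<bar> \<le> 2 * M / real (Suc (g m))"
       "\<And>m. r m i = - M \<or> A (r m) i \<le> 0" "\<And>m. s m i = M \<or> 0 \<le> A (s m) i"
      by blast
    \<comment> \<open>The inequalities are not strict, so each alternative describes a closed set
      and survives the limit; both sequences converge to the same x, where the two alternatives
      meet.\<close>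
    have cl: "closed (?K \<inter> (\<lambda>x. x i) -` {t} \<union> ?K \<inter> (\<lambda>x. A x i) -` C)" if "closed C" for t C
      using that by (intro closed_Un continuous_closed_preimage coord closedK cont i) auto
    have "r \<longlonglongrightarrow> x" "s \<longlonglongrightarrow> x"
      using near_lim rs(3,4) by blast+
    have "x \<in> ?K \<inter> (\<lambda>x. x i) -` {-M} \<union> ?K \<inter> (\<lambda>x. A x i) -` {..0}"
      by (rule closed_sequentially[OF cl _ \<open>r \<longlonglongrightarrow> x\<close>]) (use rs(1,5) in auto)
    moreover have "x \<in> ?K \<inter> (\<lambda>x. x i) -` {M} \<union> ?K \<inter> (\<lambda>x. A x i) -` {0..}"
      by (rule closed_sequentially[OF cl _ \<open>s \<longlonglongrightarrow> x\<close>]) (use rs(2,6) in auto)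
    ultimately show ?thesis
      by auto
  qed
  have "x i * A x i \<le> 0" if "i < n" for i
    using alt[OF that] M by (auto simp: mult_le_0_iff)
  then have "(\<Sum>i<n. x i * A x i) \<le> 0"
    by (intro sum_nonpos) auto
  then have "\<bar>x i\<bar> \<noteq> M" if "i < n" for i
    using coercive[OF x that] by fastforce
  then have "A x i = 0" if "i < n" for i
    using alt[OF that] that M by fastforce
  then show ?thesis
    using x by blast
qed

section \<open>Smooth bump functions\<close>

text \<open>Carrying a polynomial along makes the family closed under differentiation, so smoothness
  becomes an induction over k for all P at once. P = 1 gives the classical flat function
  exp(-1/t).\<close>

definition flat_exp :: "real poly \<Rightarrow> real \<Rightarrow> real" where
  "flat_exp P t = (if t \<le> 0 then 0 else poly P (1 / t) * exp (- (1 / t)))"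

lemma poly_times_exp_minus_tendsto_0: "((\<lambda>y. poly P y * exp (- y)) \<longlongrightarrow> 0) (at_top :: real filter)"
proof -
  have "((\<lambda>y. y ^ k / exp y) \<longlongrightarrow> (0::real)) at_top" for k
    by (rule tendsto_power_div_exp_0)
  then have "((\<lambda>y. \<Sum>i\<le>degree P. coeff P i * (y ^ i / exp y)) \<longlongrightarrow> (\<Sum>i\<le>degree P. coeff P i * 0)) at_top"
    by (intro tendsto_intros)
  then show ?thesis
    by (simp add: poly_altdef sum_distrib_right exp_minus divide_inverse mult.assoc)
qed

text \<open>With y = 1/t one has d/dt = - y^2 d/dy, and P(y) exp(-y) has the y-derivative (P'(y) -
  P(y)) exp(-y); hence the polynomial y^2 (P - P'). At t = 0 the exponential beats every polynomial
  in y.\<close>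

lemma flat_exp_has_field_derivative:
  "(flat_exp P has_field_derivative flat_exp ([:0, 0, 1:] * (P - pderiv P)) t) (at t)"
proof -
  consider "t < 0" | "t = 0" | "0 < t" by linarith
  then show ?thesis
  proof cases
    case 1
    show ?thesis
      by (rule has_field_derivative_transform_within_open[where f = "\<lambda>_. 0" and S = "{..<0}"])
        (use 1 in \<open>auto simp: flat_exp_def\<close>)
  next
    case 2
    have "((\<lambda>h. flat_exp P h / h) \<longlongrightarrow> 0) (at_right 0)"
    proof -
      \<comment> \<open>\<open>pCons 0 P\<close> multiplies by y = 1/h: the difference quotient at 0
        is again a polynomial in y times exp(-y).\<close>
      have "((\<lambda>h. poly (pCons 0 P) (inverse h) * exp (- inverse h)) \<longlongrightarrow> 0) (at_right (0::real))"
        by (rule filterlim_compose[OF poly_times_exp_minus_tendsto_0 filterlim_inverse_at_top_right])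
      then show ?thesis
        by (rule Lim_transform_eventually)
          (auto simp: eventually_at_right_field flat_exp_def field_simps intro!: exI[of _ 1])
    qed
    moreover have "((\<lambda>h. flat_exp P h / h) \<longlongrightarrow> 0) (at_left 0)"
      by (rule Lim_transform_eventually[OF tendsto_const])
        (auto simp: eventually_at_left_field flat_exp_def intro!: exI[of _ "-1"])
    ultimately have "((\<lambda>h. flat_exp P h / h) \<longlongrightarrow> 0) (at 0)"
      by (simp add: filterlim_at_split)
    then show ?thesis
      using 2 by (simp add: DERIV_def) (simp add: flat_exp_def)
  next
    case 3
    have "((\<lambda>t. poly P (1 / t) * exp (- (1 / t))) has_field_derivative
        flat_exp ([:0, 0, 1:] * (P - pderiv P)) t) (at t)"
      using 3 by (auto intro!: derivative_eq_intros simp: flat_exp_def field_simps power2_eq_square)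
    then show ?thesis
      by (rule has_field_derivative_transform_within_open[where S = "{0<..}"])
        (use 3 in \<open>auto simp: flat_exp_def\<close>)
  qed
qed

section \<open>Sums and products of k times continuously differentiable functions\<close>

lemma Ck_Suc_imp_Ck: "Ck (Suc k) f \<Longrightarrow> Ck k f"
proof (induction k arbitrary: f)
  case 0
  then show ?case
    by (auto intro!: continuous_at_imp_continuous_on differentiable_imp_continuous_within)
next
  case (Suc k)
  from Suc.prems have "\<forall>x. f differentiable at x"
    "\<forall>i\<in>Basis. Ck (Suc k) (\<lambda>x. frechet_derivative f (at x) i)"
    using Ck.simps(2)[of "Suc k" f] by blast+
  then have "\<forall>i\<in>Basis. Ck k (\<lambda>x. frechet_derivative f (at x) i)"
    using Suc.IH by blast
  with \<open>\<forall>x. f differentiable at x\<close> show ?case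
    using Ck.simps(2)[of k f] by blast
qed

lemma Ck_const: "Ck k (\<lambda>x. c)"
  by (induction k arbitrary: c) simp_all

lemma frechet_derivative_add:
  assumes "f differentiable at x" "g differentiable at x"
  shows "frechet_derivative (\<lambda>x. f x + g x) (at x) i
    = frechet_derivative f (at x) i + frechet_derivative g (at x) i"
proof -
  have "((\<lambda>x. f x + g x) has_derivative
     (\<lambda>i. frechet_derivative f (at x) i + frechet_derivative g (at x) i)) (at x)"
    by (intro has_derivative_add) (use assms in \<open>simp_all flip: frechet_derivative_works\<close>)
  from fun_cong[OF frechet_derivative_at[OF this], of i] show ?thesis
    by simp
qed

lemma Ck_add: "Ck k f \<Longrightarrow> Ck k g \<Longrightarrow> Ck k (\<lambda>x. f x + g x)"
  by (induction k arbitrary: f g) (auto intro!: continuous_on_add simp: frechet_derivative_add)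

lemma frechet_derivative_mult:
  fixes f g :: "'a::real_normed_vector \<Rightarrow> real"
  assumes "f differentiable at x" "g differentiable at x"
  shows "frechet_derivative (\<lambda>x. f x * g x) (at x) i
    = f x * frechet_derivative g (at x) i + frechet_derivative f (at x) i * g x"
proof -
  have "((\<lambda>x. f x * g x) has_derivative
     (\<lambda>i. f x * frechet_derivative g (at x) i + frechet_derivative f (at x) i * g x)) (at x)"
    by (intro has_derivative_mult) (use assms in \<open>simp_all flip: frechet_derivative_works\<close>)
  from fun_cong[OF frechet_derivative_at[OF this], of i] show ?thesis
    by simp
qed

lemma Ck_mult: "Ck k f \<Longrightarrow> Ck k g \<Longrightarrow> Ck k (\<lambda>x. f x * g x)"
proof (induction k arbitrary: f g)
  case 0
  then show ?case
    by (simp add: continuous_on_mult)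
next
  case (Suc k)
  have "Ck k f" "Ck k g"
    using Suc.prems Ck_Suc_imp_Ck by blast+
  with Suc show ?case
    by (auto simp: frechet_derivative_mult intro!: Ck_add Suc.IH)
qed

lemma Ck_prod: "finite I \<Longrightarrow> (\<And>i. i \<in> I \<Longrightarrow> Ck k (f i)) \<Longrightarrow> Ck k (\<lambda>x. \<Prod>i\<in>I. f i x)"
  by (induction rule: finite_induct) (auto intro!: Ck_const Ck_mult)

lemma Ck_flat_exp_affine: "Ck k (\<lambda>x. flat_exp P (x \<bullet> v + d))"
proof (induction k arbitrary: P)
  case 0
  have "continuous_on UNIV (flat_exp P)"
    by (intro continuous_at_imp_continuous_on) (blast intro: DERIV_isCont flat_exp_has_field_derivative)
  then show ?case
    by (auto intro!: continuous_on_compose2[of UNIV "flat_exp P"] continuous_intros)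
next
  case (Suc k)
  let ?Q = "[:0, 0, 1:] * (P - pderiv P)"
  have D: "((\<lambda>x. flat_exp P (x \<bullet> v + d)) has_derivative (\<lambda>h. flat_exp ?Q (x \<bullet> v + d) * (h \<bullet> v))) (at x)" for x
  proof -
    have "((\<lambda>x. x \<bullet> v + d) has_derivative (\<lambda>h. h \<bullet> v)) (at x)"
      by (auto intro!: derivative_eq_intros)
    from has_derivative_compose[OF this flat_exp_has_field_derivative[of P "x \<bullet> v + d", unfolded has_field_derivative_def]]
    show ?thesis .
  qed
  have "frechet_derivative (\<lambda>x. flat_exp P (x \<bullet> v + d)) (at x) = (\<lambda>h. flat_exp ?Q (x \<bullet> v + d) * (h \<bullet> v))" for x
    using frechet_derivative_at[OF D] by simp
  moreover have "(\<lambda>x. flat_exp P (x \<bullet> v + d)) differentiable at x" for x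
    using D by (auto simp: differentiable_def)
  ultimately show ?case
    by (auto intro!: Ck_mult Ck_const Suc.IH)
qed

text \<open>Inside the box each factor is exp(-1/(k t)), where t is the distance of x to a face. As
  k grows the values rise to 1 there, while the support stays in the closed box. The arguments are
  written as an inner product plus a constant to fit \<open>Ck_flat_exp_affine\<close>.\<close>

definition box_bump :: "nat \<Rightarrow> 'a::euclidean_space \<Rightarrow> 'a \<Rightarrow> 'a \<Rightarrow> real" where
  "box_bump k a b x = (\<Prod>i\<in>Basis. flat_exp 1 (x \<bullet> (real k *\<^sub>R i) + - real k * (a \<bullet> i)) *
     flat_exp 1 (x \<bullet> (- real k *\<^sub>R i) + real k * (b \<bullet> i)))"

lemma flat_exp_1_bounds: "0 \<le> flat_exp 1 t" "flat_exp 1 t \<le> 1"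
  by (auto simp: flat_exp_def)

lemma box_bump_bounds: "0 \<le> box_bump k a b x" "box_bump k a b x \<le> 1"
  unfolding box_bump_def
  by (auto intro!: prod_nonneg prod_le_1 mult_nonneg_nonneg mult_le_one flat_exp_1_bounds)

lemma box_bump_eq_0: "x \<notin> box a b \<Longrightarrow> box_bump k a b x = 0"
proof -
  assume "x \<notin> box a b"
  then obtain i where i: "i \<in> Basis" "x \<bullet> i \<le> a \<bullet> i \<or> b \<bullet> i \<le> x \<bullet> i"
    by (auto simp: mem_box not_less)
  then have "real k * (x \<bullet> i) \<le> real k * (a \<bullet> i) \<or> real k * (b \<bullet> i) \<le> real k * (x \<bullet> i)"
    by (metis mult_left_mono of_nat_0_le_iff)
  with i show ?thesis
    unfolding box_bump_def by (auto simp: flat_exp_def intro!: bexI[of _ i])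
qed

lemma box_bump_tendsto: "(\<lambda>k. box_bump k a b x) \<longlonglongrightarrow> indicator (box a b) x"
proof (cases "x \<in> box a b")
  case True
  have exp_lim: "(\<lambda>k. flat_exp 1 (real k * t)) \<longlonglongrightarrow> 1" if "0 < t" for t
  proof -
    have "(\<lambda>k. exp (- (inverse (real k) * inverse t))) \<longlonglongrightarrow> exp (- (0 * inverse t))"
      by (intro tendsto_intros lim_inverse_n)
    then have "(\<lambda>k. exp (- (inverse (real k) * inverse t))) \<longlonglongrightarrow> 1"
      by simp
    then show ?thesis
      by (rule Lim_transform_eventually)
        (use that in \<open>auto simp: eventually_sequentially flat_exp_def field_simps mult_le_0_iff intro!: exI[of _ 1]\<close>)
  qed
  have "(\<lambda>k. flat_exp 1 (x \<bullet> (real k *\<^sub>R i) + - real k * (a \<bullet> i)) *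
     flat_exp 1 (x \<bullet> (- real k *\<^sub>R i) + real k * (b \<bullet> i))) \<longlonglongrightarrow> 1 * 1" if "i \<in> Basis" for i
  proof -
    have "0 < x \<bullet> i - a \<bullet> i" "0 < b \<bullet> i - x \<bullet> i"
      using True that by (auto simp: mem_box)
    from exp_lim[OF this(1)] exp_lim[OF this(2)]
    have "(\<lambda>k. flat_exp 1 (real k * (x \<bullet> i - a \<bullet> i)) * flat_exp 1 (real k * (b \<bullet> i - x \<bullet> i))) \<longlonglongrightarrow> 1 * 1"
      by (rule tendsto_mult)
    then show ?thesis
      by (simp add: algebra_simps)
  qed
  then have "(\<lambda>k. box_bump k a b x) \<longlonglongrightarrow> (\<Prod>i\<in>(Basis::'a set). 1)"
    unfolding box_bump_def by (intro tendsto_prod) auto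
  with True show ?thesis
    by simp
qed (simp add: box_bump_eq_0)

lemma box_bump_test_function:
  assumes "cbox a b \<subseteq> \<Omega>"
  shows "box_bump k a b \<in> test_functions \<Omega>"
proof -
  have "Ck j (box_bump k a b)" for j
    unfolding box_bump_def by (intro Ck_prod Ck_mult Ck_flat_exp_affine) auto
  moreover have sub: "closure {x. box_bump k a b x \<noteq> 0} \<subseteq> cbox a b"
    by (intro closure_minimal) (use box_bump_eq_0[of _ a b k] box_subset_cbox[of a b] in auto)
  then have "compact (closure {x. box_bump k a b x \<noteq> 0})"
    using compact_Int_closed[OF compact_cbox, of "closure {x. box_bump k a b x \<noteq> 0}" a b]
    by (simp add: Int_absorb1)
  ultimately show ?thesis
    using assms sub unfolding test_functions_def by blast
qed

section \<open>The fundamental lemma of the calculus of variations\<close>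

text \<open>Lebesgue measure restricted to a measurable set is complete, so a change on a null set
  keeps a function measurable. This serves for \<open>grad\<close>, whose choice guarantees only
  local integrability, and for limits that exist only almost everywhere.\<close>

lemma borel_measurable_lebesgue_on_cong_AE:
  fixes f g :: "'a::euclidean_space \<Rightarrow> 'b::topological_space"
  assumes \<Omega>: "\<Omega> \<in> sets lebesgue" and f: "f \<in> borel_measurable (lebesgue_on \<Omega>)"
    and ae: "AE x in lebesgue_on \<Omega>. f x = g x"
  shows "g \<in> borel_measurable (lebesgue_on \<Omega>)"
proof -
  interpret complete_measure "lebesgue_on \<Omega>"
  proof
    fix A B assume "B \<subseteq> A" "A \<in> null_sets (lebesgue_on \<Omega>)"
    then have "A \<subseteq> \<Omega>" "A \<in> null_sets lebesgue"
      using \<Omega> by (simp_all add: null_sets_restrict_space)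
    with \<open>B \<subseteq> A\<close> have "B \<subseteq> \<Omega>" "B \<in> sets lebesgue"
      by (auto intro: completion.complete)
    then show "B \<in> sets (lebesgue_on \<Omega>)"
      using \<Omega> by (simp add: sets_restrict_space_iff)
  qed
  show ?thesis
  proof (rule measurableI)
    fix A :: "'b set" assume A: "A \<in> sets borel"
    show "g -` A \<inter> space (lebesgue_on \<Omega>) \<in> sets (lebesgue_on \<Omega>)"
    proof (rule in_sets_AE)
      show "f -` A \<inter> space (lebesgue_on \<Omega>) \<in> sets (lebesgue_on \<Omega>)"
        using f A by (rule measurable_sets)
      show "AE x in lebesgue_on \<Omega>. x \<in> f -` A \<inter> space (lebesgue_on \<Omega>) \<longleftrightarrow> x \<in> g -` A \<inter> space (lebesgue_on \<Omega>)"
        using ae by eventually_elim auto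
    qed simp
  qed simp
qed

lemma integrable_lebesgue_on_subset_iff:
  fixes h :: "'a::euclidean_space \<Rightarrow> 'b::{banach, second_countable_topology}"
  assumes "K \<in> sets lebesgue" "\<Omega> \<in> sets lebesgue" "K \<subseteq> \<Omega>"
  shows "integrable (lebesgue_on K) h \<longleftrightarrow> integrable (lebesgue_on \<Omega>) (\<lambda>x. indicator K x *\<^sub>R h x)"
proof -
  have eq: "indicator K x *\<^sub>R h x = indicator \<Omega> x *\<^sub>R indicator K x *\<^sub>R h x" for x
    using assms(3) by (auto simp: indicator_def)
  show ?thesis
    using assms by (simp only: integrable_restrict_space sets.Int_space_eq2 flip: eq)
qed

lemma integrable_mult_compact_support:
  fixes h :: "'a::euclidean_space \<Rightarrow> real"
  assumes \<Omega>: "open \<Omega>" and h: "locally_integrable \<Omega> h"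
    and \<psi>: "continuous_on UNIV \<psi>" "compact K" "K \<subseteq> \<Omega>" "\<And>x. x \<notin> K \<Longrightarrow> \<psi> x = 0"
  shows "integrable (lebesgue_on \<Omega>) (\<lambda>x. h x * \<psi> x)"
proof -
  have int: "integrable (lebesgue_on \<Omega>) (\<lambda>x. indicator K x *\<^sub>R h x)"
    using h \<psi>(2,3) \<Omega> integrable_lebesgue_on_subset_iff[of K \<Omega> h]
    by (auto simp: locally_integrable_def compact_imp_closed)
  obtain C where C: "\<And>x. x \<in> K \<Longrightarrow> norm (\<psi> x) \<le> C"
    using compact_imp_bounded[OF compact_continuous_image[OF continuous_on_subset[OF \<psi>(1)] \<psi>(2)]]
    by (auto simp: bounded_iff)
  have meas: "\<psi> \<in> borel_measurable (lebesgue_on \<Omega>)"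
    using \<psi>(1) \<Omega> by (intro continuous_imp_measurable_on_sets_lebesgue) (auto intro: continuous_on_subset)
  have "integrable (lebesgue_on \<Omega>) (\<lambda>x. (indicator K x *\<^sub>R h x) * \<psi> x)"
  proof (rule Bochner_Integration.integrable_bound)
    show "integrable (lebesgue_on \<Omega>) (\<lambda>x. C * (indicator K x *\<^sub>R h x))"
      using int by (rule integrable_mult_right)
    show "(\<lambda>x. indicator K x *\<^sub>R h x * \<psi> x) \<in> borel_measurable (lebesgue_on \<Omega>)"
      using borel_measurable_integrable[OF int] meas by measurable
    have "norm (indicator K x *\<^sub>R h x * \<psi> x) \<le> norm (C * (indicator K x *\<^sub>R h x))" for x
    proof (cases "x \<in> K")
      case True
      then have "\<bar>\<psi> x\<bar> \<le> \<bar>C\<bar>"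
        using C[of x] by simp
      then show ?thesis
        using True by (simp add: abs_mult mult.commute mult_right_mono)
    qed simp
    then show "AE x in lebesgue_on \<Omega>. norm (indicator K x *\<^sub>R h x * \<psi> x) \<le> norm (C * (indicator K x *\<^sub>R h x))"
      by simp
  qed
  moreover have "(indicator K x *\<^sub>R h x) * \<psi> x = h x * \<psi> x" for x
    using \<psi>(4)[of x] by (auto simp: indicator_def)
  ultimately show ?thesis
    by (simp only:)
qed

text \<open>The bumps lie between 0 and 1, vanish off the box and converge to its indicator, so
  dominated convergence carries the identity from test functions to boxes. The dominating function
  is the modulus of h on \<open>cbox a b\<close>, a compact subset of \<Omega>.\<close>

lemma integral_box_eq_0:
  fixes h :: "'a::euclidean_space \<Rightarrow> real"
  assumes \<Omega>: "open \<Omega>" and h: "locally_integrable \<Omega> h"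
    and zero: "\<And>\<phi>. \<phi> \<in> test_functions \<Omega> \<Longrightarrow> (LINT x|lebesgue_on \<Omega>. h x * \<phi> x) = 0"
    and ab: "cbox a b \<subseteq> \<Omega>"
  shows "(LINT x|lebesgue. indicator (box a b) x *\<^sub>R h x) = 0"
proof -
  have int: "integrable lebesgue (\<lambda>x. indicator (cbox a b) x *\<^sub>R h x)"
  proof -
    have "integrable (lebesgue_on (cbox a b)) h"
      using h ab by (auto simp: locally_integrable_def)
    then show ?thesis
      by (subst (asm) integrable_restrict_space) auto
  qed
  have meas: "(\<lambda>x. indicator (cbox a b) x *\<^sub>R h x * box_bump k a b x) \<in> borel_measurable lebesgue" for k
  proof -
    have "continuous_on UNIV (box_bump k a b)"
      using box_bump_test_function[OF ab, of k] unfolding test_functions_def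
      by (metis (mono_tags, lifting) Ck.simps(1) mem_Collect_eq)
    then have "box_bump k a b \<in> borel_measurable lborel"
      by (simp add: borel_measurable_continuous_onI)
    then have "box_bump k a b \<in> borel_measurable lebesgue"
      by (rule measurable_completion)
    then show ?thesis
      using borel_measurable_integrable[OF int] by measurable
  qed
  have cb: "indicator (cbox a b) x *\<^sub>R h x * indicator (box a b) x = indicator (box a b) x *\<^sub>R h x" for x
    using box_subset_cbox[of a b] by (auto simp: indicator_def)
  have "(\<lambda>k. LINT x|lebesgue. indicator (cbox a b) x *\<^sub>R h x * box_bump k a b x)
    \<longlonglongrightarrow> (LINT x|lebesgue. indicator (cbox a b) x *\<^sub>R h x * indicator (box a b) x)"
  proof (rule integral_dominated_convergence)
    show "integrable lebesgue (\<lambda>x. norm (indicator (cbox a b) x *\<^sub>R h x))"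
      using int by (rule integrable_norm)
    show "AE x in lebesgue. (\<lambda>k. indicator (cbox a b) x *\<^sub>R h x * box_bump k a b x)
        \<longlonglongrightarrow> indicator (cbox a b) x *\<^sub>R h x * indicator (box a b) x"
      by (intro AE_I2 tendsto_mult tendsto_const box_bump_tendsto)
    show "AE x in lebesgue. norm (indicator (cbox a b) x *\<^sub>R h x * box_bump k a b x)
        \<le> norm (indicator (cbox a b) x *\<^sub>R h x)" for k
      using box_bump_bounds[of k a b] by (auto simp: abs_mult intro!: mult_left_le)
    show "(\<lambda>x. indicator (cbox a b) x *\<^sub>R h x * indicator (box a b) x) \<in> borel_measurable lebesgue"
      by (intro borel_measurable_times borel_measurable_integrable[OF int] borel_measurable_indicator) simp
  qed (rule meas)
  moreover have "(LINT x|lebesgue. indicator (cbox a b) x *\<^sub>R h x * box_bump k a b x) = 0" for k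
  proof -
    have "(LINT x|lebesgue. indicator \<Omega> x *\<^sub>R (h x * box_bump k a b x)) = 0"
      using zero[OF box_bump_test_function[OF ab, of k]] \<Omega>
      by (subst (asm) integral_restrict_space) auto
    moreover have "indicator \<Omega> x *\<^sub>R (h x * box_bump k a b x)
        = indicator (cbox a b) x *\<^sub>R h x * box_bump k a b x" for x
      using box_bump_eq_0[of x a b k] ab box_subset_cbox[of a b] by (auto simp: indicator_def)
    ultimately show ?thesis
      by (simp only:)
  qed
  ultimately have "(LINT x|lebesgue. indicator (cbox a b) x *\<^sub>R h x * indicator (box a b) x) = 0"
    by (simp add: LIMSEQ_const_iff)
  then show ?thesis
    by (simp only: cb)
qed

lemma sigma_finite_lebesgue: "sigma_finite_measure (lebesgue :: 'a::euclidean_space measure)"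
proof
  obtain A :: "'a set set" where "countable A" "A \<subseteq> sets lborel" "\<Union>A = space lborel"
    "\<forall>a\<in>A. emeasure lborel a \<noteq> \<infinity>"
    using lborel.sigma_finite_countable by blast
  then show "\<exists>A. countable A \<and> A \<subseteq> sets lebesgue \<and> \<Union>A = space (lebesgue :: 'a measure) \<and>
      (\<forall>a\<in>A. emeasure lebesgue a \<noteq> \<infinity>)"
    by (intro exI[of _ A]) (auto simp: subset_eq)
qed

text \<open>A Dynkin system argument: open boxes are stable under intersection and generate the
  Borel sets. Truncating h to the large box makes it integrable, so complements are handled by
  subtraction and disjoint unions by summation. Lebesgue sets differ from Borel sets only by null
  sets.\<close>

lemma AE_zero_on_box:
  fixes h :: "'a::euclidean_space \<Rightarrow> real"
  assumes int: "integrable lebesgue (\<lambda>x. indicator (box c d) x *\<^sub>R h x)"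
    and zero: "\<And>a b. box a b \<subseteq> box c d \<Longrightarrow> (LINT x|lebesgue. indicator (box a b) x *\<^sub>R h x) = 0"
  shows "AE x in lebesgue. x \<in> box c d \<longrightarrow> h x = 0"
proof -
  let ?g = "\<lambda>x. indicator (box c d) x *\<^sub>R h x"
  have borel: "(LINT x|lebesgue. indicator A x *\<^sub>R ?g x) = 0" if "A \<in> sets borel" for A
  proof -
    have "Int_stable (range (\<lambda>(a, b). box a b :: 'a set))"
      by (auto simp: Int_stable_def box_Int_box)
    moreover have "range (\<lambda>(a, b). box a b :: 'a set) \<subseteq> Pow UNIV"
      by simp
    moreover have "A \<in> sigma_sets UNIV (range (\<lambda>(a, b). box a b))"
      using that unfolding borel_eq_box by simp
    ultimately show ?thesis
    proof (induction rule: sigma_sets_induct_disjoint)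
      case (basic A)
      then obtain a b where "A = box a b" by auto
      then obtain a' b' where "A \<inter> box c d = box a' b'"
        by (auto simp: box_Int_box)
      moreover have "indicator A x *\<^sub>R ?g x = indicator (A \<inter> box c d) x *\<^sub>R h x" for x
        by (simp add: indicator_inter_arith)
      ultimately show ?case
        using zero by (metis (no_types, lifting) Int_lower2 Bochner_Integration.integral_cong)
    next
      case (compl A)
      then have A: "A \<in> sets borel"
        unfolding borel_eq_box by simp
      have "integrable lebesgue (\<lambda>x. indicator A x *\<^sub>R ?g x)"
        using A by (intro integrable_mult_indicator int) simp
      moreover have "indicator (UNIV - A) x *\<^sub>R ?g x = ?g x - indicator A x *\<^sub>R ?g x" for x
        by (auto simp: indicator_def)
      ultimately show ?case
        using compl int zero[of c d] by (simp add: Bochner_Integration.integral_diff)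
    next
      case (union A)
      then have A: "A i \<in> sets borel" for i
        unfolding borel_eq_box by auto
      have "(LINT x:(\<Union>i. A i)|lebesgue. ?g x) = (\<Sum>i. (LINT x:(A i)|lebesgue. ?g x))"
      proof (rule lebesgue_integral_countable_add)
        show "A i \<inter> A j = {}" if "i \<noteq> j" for i j
          using union(1) that by (auto simp: disjoint_family_on_def)
        show "set_integrable lebesgue (\<Union> (range A)) ?g"
          unfolding set_integrable_def using A by (intro integrable_mult_indicator int) auto
      qed (use A in simp)
      then show ?case
        using union(3) by (simp add: set_lebesgue_integral_def)
    qed simp
  qed
  have "AE x in lebesgue. ?g x = 0"
  proof (rule sigma_finite_measure.density_zero)
    show "sigma_finite_measure (lebesgue :: 'a measure)"
      by (rule sigma_finite_lebesgue)
    fix A :: "'a set" assume "A \<in> sets lebesgue"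
    then obtain S N N' where A: "A = S \<union> N" "N \<subseteq> N'" "N' \<in> null_sets lborel" "S \<in> sets lborel"
      by (rule sets_completionE)
    have "AE x in lebesgue. x \<notin> N'"
      using A(3) by (intro AE_not_in null_sets_completionI)
    then have "AE x in lebesgue. indicator A x *\<^sub>R ?g x = indicator S x *\<^sub>R ?g x"
      by eventually_elim (use A in \<open>auto simp: indicator_def\<close>)
    then have "(LINT x|lebesgue. indicator A x *\<^sub>R ?g x) = (LINT x|lebesgue. indicator S x *\<^sub>R ?g x)"
      using A(4) \<open>A \<in> sets lebesgue\<close>
      by (intro integral_cong_AE borel_measurable_integrable integrable_mult_indicator int) auto
    then show "set_lebesgue_integral lebesgue A ?g = 0"
      using borel A(4) by (simp add: set_lebesgue_integral_def)
  qed (rule int)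
  then show ?thesis
    by eventually_elim (auto simp: indicator_def)
qed

text \<open>A locally integrable function may fail to be integrable on \<Omega>. Hence \<Omega> is
  covered by countably many closed boxes, on each of which it is integrable, and the exceptional
  null sets are united. The boundaries of the boxes are null as well.\<close>

lemma fundamental_lemma_calculus_of_variations:
  fixes h :: "'a::euclidean_space \<Rightarrow> real"
  assumes \<Omega>: "open \<Omega>" and h: "locally_integrable \<Omega> h"
    and zero: "\<And>\<phi>. \<phi> \<in> test_functions \<Omega> \<Longrightarrow> (LINT x|lebesgue_on \<Omega>. h x * \<phi> x) = 0"
  shows "AE x in lebesgue_on \<Omega>. h x = 0"
proof -
  obtain \<D> where \<D>: "countable \<D>" "\<D> \<subseteq> Pow \<Omega>" "\<And>X. X \<in> \<D> \<Longrightarrow> \<exists>a b. X = cbox a b" "\<Union>\<D> = \<Omega>"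
    using open_countable_Union_open_cbox[OF \<Omega>] by metis
  have "AE x in lebesgue. x \<in> X \<longrightarrow> h x = 0" if X: "X \<in> \<D>" for X
  proof -
    obtain c d where cd: "X = cbox c d"
      using \<D>(3)[OF X] by blast
    then have sub: "cbox c d \<subseteq> \<Omega>"
      using \<D>(2) X by blast
    have "integrable (lebesgue_on (cbox c d)) h"
      using h sub by (auto simp: locally_integrable_def)
    then have int: "integrable lebesgue (\<lambda>x. indicator (cbox c d) x *\<^sub>R h x)"
      by (subst (asm) integrable_restrict_space) auto
    have "integrable lebesgue (\<lambda>x. indicator (box c d) x *\<^sub>R indicator (cbox c d) x *\<^sub>R h x)"
      by (rule integrable_mult_indicator[OF _ int]) simp
    moreover have "indicator (box c d) x *\<^sub>R indicator (cbox c d) x *\<^sub>R h x = indicator (box c d) x *\<^sub>R h x" for x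
      using box_subset_cbox[of c d] by (auto simp: indicator_def)
    ultimately have "integrable lebesgue (\<lambda>x. indicator (box c d) x *\<^sub>R h x)"
      by (simp only:)
    then have "AE x in lebesgue. x \<in> box c d \<longrightarrow> h x = 0"
    proof (rule AE_zero_on_box)
      fix a b assume ab: "box a b \<subseteq> box c d"
      show "(LINT x|lebesgue. indicator (box a b) x *\<^sub>R h x) = 0"
      \<comment> \<open>\<open>cbox a b\<close> is the closure of \<open>box a b\<close> only if the
        latter is nonempty; over an empty box the integral is 0 anyway.\<close>
      proof (cases "box a b = {}")
        case False
        then have "cbox a b \<subseteq> cbox c d"
          using closure_mono[OF ab] by (metis closure_box box_eq_empty ab subset_empty)
        then show ?thesis
          using integral_box_eq_0[OF \<Omega> h zero] sub by blast
      qed simp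
    qed
    moreover have "AE x in lebesgue. x \<notin> cbox c d - box c d"
      using negligible_frontier_interval[of c d] by (intro AE_not_in) (simp add: negligible_iff_null_sets)
    ultimately show ?thesis
      unfolding cd by eventually_elim auto
  qed
  then have "AE x in lebesgue. \<forall>X\<in>\<D>. x \<in> X \<longrightarrow> h x = 0"
    using \<D>(1) by (subst AE_ball_countable) auto
  then have "AE x in lebesgue. x \<in> \<Omega> \<longrightarrow> h x = 0"
    by eventually_elim (use \<D>(4) in blast)
  then show ?thesis
    using \<Omega> by (subst AE_restrict_space_iff) auto
qed

section \<open>Weak gradients\<close>

lemma test_function_support:
  assumes "\<phi> \<in> test_functions \<Omega>"
  obtains K where "compact K" "K \<subseteq> \<Omega>" "continuous_on UNIV \<phi>" "\<And>x. x \<notin> K \<Longrightarrow> \<phi> x = 0"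
    "\<And>i. i \<in> Basis \<Longrightarrow> continuous_on UNIV (\<lambda>x. frechet_derivative \<phi> (at x) i)"
    "\<And>x i. x \<notin> K \<Longrightarrow> frechet_derivative \<phi> (at x) i = 0"
proof (rule that[of "closure {x. \<phi> x \<noteq> 0}"])
  let ?K = "closure {x. \<phi> x \<noteq> 0}"
  have Ck: "Ck k \<phi>" for k
    using assms by (auto simp: test_functions_def)
  show "compact ?K" "?K \<subseteq> \<Omega>"
    using assms by (auto simp: test_functions_def)
  show "continuous_on UNIV \<phi>"
    using Ck[of 0] by simp
  show zero: "\<phi> x = 0" if "x \<notin> ?K" for x
    using that closure_subset[of "{x. \<phi> x \<noteq> 0}"] by auto
  show "continuous_on UNIV (\<lambda>x. frechet_derivative \<phi> (at x) i)" if "i \<in> Basis" for i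
    using Ck[of "Suc 0"] that by simp
  show "frechet_derivative \<phi> (at x) i = 0" if "x \<notin> ?K" for x i
  proof -
    have "((\<lambda>_. 0) has_derivative (\<lambda>_. 0)) (at x)"
      by (rule has_derivative_const)
    then have "(\<phi> has_derivative (\<lambda>_. 0)) (at x)"
    proof (rule has_derivative_transform_within_open[where s = "- ?K"])
      show "open (- ?K)"
        by (intro open_Compl closed_closure)
      show "x \<in> - ?K"
        using that by simp
      show "0 = \<phi> y" if "y \<in> - ?K" for y
        using zero[of y] that by (metis ComplD)
    qed
    from fun_cong[OF frechet_derivative_at[OF this], of i] show ?thesis
      by simp
  qed
qed

lemma integrable_mult_test_function:
  fixes h :: "'a::euclidean_space \<Rightarrow> real"
  assumes "open \<Omega>" "locally_integrable \<Omega> h" "\<phi> \<in> test_functions \<Omega>"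
  shows "integrable (lebesgue_on \<Omega>) (\<lambda>x. h x * \<phi> x)"
    and "i \<in> Basis \<Longrightarrow> integrable (lebesgue_on \<Omega>) (\<lambda>x. h x * frechet_derivative \<phi> (at x) i)"
proof -
  obtain K where K: "compact K" "K \<subseteq> \<Omega>" "continuous_on UNIV \<phi>" "\<And>x. x \<notin> K \<Longrightarrow> \<phi> x = 0"
    "\<And>i. i \<in> Basis \<Longrightarrow> continuous_on UNIV (\<lambda>x. frechet_derivative \<phi> (at x) i)"
    "\<And>x i. x \<notin> K \<Longrightarrow> frechet_derivative \<phi> (at x) i = 0"
    using test_function_support[OF assms(3)] by blast
  show "integrable (lebesgue_on \<Omega>) (\<lambda>x. h x * \<phi> x)"
    by (rule integrable_mult_compact_support[OF assms(1,2) K(3,1,2,4)])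
  show "integrable (lebesgue_on \<Omega>) (\<lambda>x. h x * frechet_derivative \<phi> (at x) i)" if "i \<in> Basis"
    by (rule integrable_mult_compact_support[OF assms(1,2) K(5)[OF that] K(1,2,6)])
qed

lemma locally_integrable_inner:
  fixes g :: "'a::euclidean_space \<Rightarrow> 'a"
  shows "locally_integrable \<Omega> g \<Longrightarrow> locally_integrable \<Omega> (\<lambda>x. g x \<bullet> i)"
  by (auto simp: locally_integrable_def)

lemma locally_integrable_lincomb:
  fixes u v :: "'a::euclidean_space \<Rightarrow> 'b::{banach, second_countable_topology}"
  shows "locally_integrable \<Omega> u \<Longrightarrow> locally_integrable \<Omega> v \<Longrightarrow>
    locally_integrable \<Omega> (\<lambda>x. a *\<^sub>R u x + b *\<^sub>R v x)"
  by (auto simp: locally_integrable_def)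

lemma weak_gradient_lincomb:
  assumes \<Omega>: "open \<Omega>" and u: "weak_gradient \<Omega> u g" and v: "weak_gradient \<Omega> v h"
  shows "weak_gradient \<Omega> (\<lambda>x. a * u x + b * v x) (\<lambda>x. a *\<^sub>R g x + b *\<^sub>R h x)"
  unfolding weak_gradient_def
proof (intro conjI ballI)
  have loc: "locally_integrable \<Omega> u" "locally_integrable \<Omega> v" "locally_integrable \<Omega> g" "locally_integrable \<Omega> h"
    using u v by (simp_all add: weak_gradient_def)
  show "locally_integrable \<Omega> (\<lambda>x. a * u x + b * v x)"
    using locally_integrable_lincomb[OF loc(1,2), of a b] by simp
  show "locally_integrable \<Omega> (\<lambda>x. a *\<^sub>R g x + b *\<^sub>R h x)"
    by (intro locally_integrable_lincomb loc)
  fix \<phi> :: "'a \<Rightarrow> real" and i :: 'a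
  assume \<phi>: "\<phi> \<in> test_functions \<Omega>" and i: "i \<in> Basis"
  let ?D = "\<lambda>x. frechet_derivative \<phi> (at x) i"
  have "(LINT x|lebesgue_on \<Omega>. (a * u x + b * v x) * ?D x)
    = a * (LINT x|lebesgue_on \<Omega>. u x * ?D x) + b * (LINT x|lebesgue_on \<Omega>. v x * ?D x)"
    using integrable_mult_test_function(2)[OF \<Omega> loc(1) \<phi> i] integrable_mult_test_function(2)[OF \<Omega> loc(2) \<phi> i]
    by (simp add: ring_distribs mult.assoc)
  also have "\<dots> = - (a * (LINT x|lebesgue_on \<Omega>. (g x \<bullet> i) * \<phi> x) + b * (LINT x|lebesgue_on \<Omega>. (h x \<bullet> i) * \<phi> x))"
    using u v \<phi> i by (simp add: weak_gradient_def)
  also have "\<dots> = - (LINT x|lebesgue_on \<Omega>. ((a *\<^sub>R g x + b *\<^sub>R h x) \<bullet> i) * \<phi> x)"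
    using integrable_mult_test_function(1)[OF \<Omega> locally_integrable_inner[OF loc(3)] \<phi>, of i]
      integrable_mult_test_function(1)[OF \<Omega> locally_integrable_inner[OF loc(4)] \<phi>, of i]
    by (simp add: inner_add_left ring_distribs mult.assoc)
  finally show "(LINT x|lebesgue_on \<Omega>. (a * u x + b * v x) * ?D x)
    = - (LINT x|lebesgue_on \<Omega>. ((a *\<^sub>R g x + b *\<^sub>R h x) \<bullet> i) * \<phi> x)" .
qed

text \<open>Every component of the difference integrates to 0 against every test function.\<close>

lemma weak_gradient_unique:
  assumes \<Omega>: "open \<Omega>" and g: "weak_gradient \<Omega> u g" and h: "weak_gradient \<Omega> u h"
  shows "AE x in lebesgue_on \<Omega>. g x = h x"
proof -
  have loc: "locally_integrable \<Omega> g" "locally_integrable \<Omega> h"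
    using g h by (simp_all add: weak_gradient_def)
  have "AE x in lebesgue_on \<Omega>. (g x - h x) \<bullet> i = 0" if i: "i \<in> Basis" for i
  proof (rule fundamental_lemma_calculus_of_variations[OF \<Omega>])
    show "locally_integrable \<Omega> (\<lambda>x. (g x - h x) \<bullet> i)"
      using locally_integrable_inner[OF locally_integrable_lincomb[OF loc, of 1 "-1"]] by simp
    fix \<phi> assume \<phi>: "\<phi> \<in> test_functions \<Omega>"
    have "(LINT x|lebesgue_on \<Omega>. (g x \<bullet> i) * \<phi> x) = (LINT x|lebesgue_on \<Omega>. (h x \<bullet> i) * \<phi> x)"
      using g h \<phi> i by (simp add: weak_gradient_def)
    then show "(LINT x|lebesgue_on \<Omega>. (g x - h x) \<bullet> i * \<phi> x) = 0"
      using integrable_mult_test_function(1)[OF \<Omega> locally_integrable_inner[OF loc(1)] \<phi>, of i]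
        integrable_mult_test_function(1)[OF \<Omega> locally_integrable_inner[OF loc(2)] \<phi>, of i]
      by (simp add: inner_diff_left left_diff_distrib)
  qed
  then have "AE x in lebesgue_on \<Omega>. \<forall>i\<in>Basis. (g x - h x) \<bullet> i = 0"
    by (subst AE_ball_countable) (auto intro: countable_finite)
  then show ?thesis
    by eventually_elim (auto intro: euclidean_eqI simp: inner_diff_left)
qed

lemma weak_gradient_cong_AE:
  fixes u v :: "'a::euclidean_space \<Rightarrow> real"
  assumes \<Omega>: "open \<Omega>" and u: "weak_gradient \<Omega> u g" and uv: "AE x in lebesgue_on \<Omega>. u x = v x"
  shows "weak_gradient \<Omega> v g"
  unfolding weak_gradient_def
proof (intro conjI ballI)
  have "integrable (lebesgue_on K) v" if K: "compact K" "K \<subseteq> \<Omega>" for K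
  proof -
    have K': "K \<in> sets lebesgue"
      using K by (simp add: compact_imp_closed)
    have ae: "AE x in lebesgue_on K. u x = v x"
      using uv K K' \<Omega> by (auto simp: AE_restrict_space_iff)
    have int: "integrable (lebesgue_on K) u"
      using u K by (auto simp: weak_gradient_def locally_integrable_def)
    have "v \<in> borel_measurable (lebesgue_on K)"
      by (rule borel_measurable_lebesgue_on_cong_AE[OF K' borel_measurable_integrable[OF int] ae])
    then show ?thesis
      using integrable_cong_AE[OF borel_measurable_integrable[OF int] _ ae] int by blast
  qed
  then show v: "locally_integrable \<Omega> v"
    by (auto simp: locally_integrable_def)
  show "locally_integrable \<Omega> g"
    using u by (simp add: weak_gradient_def)
  fix \<phi> :: "'a \<Rightarrow> real" and i :: 'a
  assume \<phi>: "\<phi> \<in> test_functions \<Omega>" and i: "i \<in> Basis"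
  have "(LINT x|lebesgue_on \<Omega>. v x * frechet_derivative \<phi> (at x) i)
      = (LINT x|lebesgue_on \<Omega>. u x * frechet_derivative \<phi> (at x) i)"
  proof (rule integral_cong_AE)
    show "(\<lambda>x. v x * frechet_derivative \<phi> (at x) i) \<in> borel_measurable (lebesgue_on \<Omega>)"
      by (intro borel_measurable_integrable integrable_mult_test_function(2) \<Omega> v \<phi> i)
    show "(\<lambda>x. u x * frechet_derivative \<phi> (at x) i) \<in> borel_measurable (lebesgue_on \<Omega>)"
      using u by (intro borel_measurable_integrable integrable_mult_test_function(2) \<Omega> \<phi> i)
        (simp add: weak_gradient_def)
    show "AE x in lebesgue_on \<Omega>. v x * frechet_derivative \<phi> (at x) i = u x * frechet_derivative \<phi> (at x) i"
      using uv by eventually_elim simp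
  qed
  also have "\<dots> = - (LINT x|lebesgue_on \<Omega>. (g x \<bullet> i) * \<phi> x)"
    using u \<phi> i by (simp add: weak_gradient_def)
  finally show "(LINT x|lebesgue_on \<Omega>. v x * frechet_derivative \<phi> (at x) i)
     = - (LINT x|lebesgue_on \<Omega>. (g x \<bullet> i) * \<phi> x)" .
qed

section \<open>The chosen gradient\<close>

lemma weak_gradient_grad: "weak_gradient \<Omega> u g \<Longrightarrow> weak_gradient \<Omega> u (grad \<Omega> u)"
  unfolding grad_def by (rule someI[of "weak_gradient \<Omega> u"])

lemma grad_eq_AE: "open \<Omega> \<Longrightarrow> weak_gradient \<Omega> u g \<Longrightarrow> AE x in lebesgue_on \<Omega>. grad \<Omega> u x = g x"
  using weak_gradient_unique weak_gradient_grad by blast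

text \<open>The choice in \<open>grad\<close> is made from the predicate
  \<open>weak_gradient \<Omega> u\<close>, and this predicate is the same for u and v. Hence
  equality at every point, not merely almost everywhere.\<close>

lemma grad_cong_AE:
  assumes "open \<Omega>" "AE x in lebesgue_on \<Omega>. u x = v x"
  shows "grad \<Omega> u = grad \<Omega> v"
proof -
  have "AE x in lebesgue_on \<Omega>. v x = u x"
    using assms(2) by eventually_elim simp
  then have "weak_gradient \<Omega> u = weak_gradient \<Omega> v"
    using assms weak_gradient_cong_AE[of \<Omega> u _ v] weak_gradient_cong_AE[of \<Omega> v _ u] by blast
  then show ?thesis
    by (simp add: grad_def)
qed

lemma weak_gradient_sum:
  fixes n :: nat
  assumes \<Omega>: "open \<Omega>" and "\<And>i. i < n \<Longrightarrow> weak_gradient \<Omega> (w i) (g i)"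
  shows "weak_gradient \<Omega> (\<lambda>x. \<Sum>i<n. c i * w i x) (\<lambda>x. \<Sum>i<n. c i *\<^sub>R g i x)"
  using assms(2)
proof (induction n)
  case 0
  show ?case
    by (simp add: weak_gradient_def locally_integrable_def)
next
  case (Suc n)
  then show ?case
    using weak_gradient_lincomb[OF \<Omega> Suc.IH Suc.prems[of n], of 1 "c n"] by simp
qed

lemma grad_lincomb_AE:
  assumes \<Omega>: "open \<Omega>" and u: "weak_gradient \<Omega> u g" and v: "weak_gradient \<Omega> v h"
  shows "AE x in lebesgue_on \<Omega>. grad \<Omega> (\<lambda>x. a * u x + b * v x) x = a *\<^sub>R grad \<Omega> u x + b *\<^sub>R grad \<Omega> v x"
  by (intro grad_eq_AE weak_gradient_lincomb weak_gradient_grad[OF u] weak_gradient_grad[OF v] \<Omega>)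

section \<open>Hoelder and Vitali\<close>

text \<open>Meaningful only when the power is integrable; otherwise the value is \<open>0\<close>.\<close>

definition lp_norm :: "'a measure \<Rightarrow> real \<Rightarrow> ('a \<Rightarrow> 'b::real_normed_vector) \<Rightarrow> real" where
  "lp_norm M r u = (LINT x|M. norm (u x) powr r) powr (1 / r)"

lemma lp_norm_nonneg [simp]: "0 \<le> lp_norm M r u"
  by (simp add: lp_norm_def)

lemma lp_norm_powr: "0 < r \<Longrightarrow> lp_norm M r u powr r = (LINT x|M. norm (u x) powr r)"
  by (simp add: lp_norm_def powr_powr)

lemma lp_norm_eq_0_iff_AE:
  assumes "integrable M (\<lambda>x. norm (u x) powr r)"
  shows "lp_norm M r u = 0 \<longleftrightarrow> (AE x in M. u x = 0)"
  using integral_nonneg_eq_0_iff_AE[OF assms] by (auto simp: lp_norm_def)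

text \<open>Young's inequality for the conjugate exponents P/a and P/(P-a). The power a on F
  reflects the growth condition: the pairs (P, a) that occur later are those of \<open>pstar\<close>
  with \<alpha>, of p with \<beta>, and, for \<sigma>, of the conjugate of r with 1.\<close>

lemma integrable_powr_mult:
  fixes F :: "'a \<Rightarrow> 'b::{real_normed_vector}" and G :: "'a \<Rightarrow> real"
  assumes a: "0 < a" "a < P"
    and F: "(\<lambda>x. norm (F x)) \<in> borel_measurable M" "integrable M (\<lambda>x. norm (F x) powr P)"
    and G: "G \<in> borel_measurable M" "integrable M (\<lambda>x. norm (G x) powr (P / (P - a)))"
  shows "integrable M (\<lambda>x. norm (F x) powr a * \<bar>G x\<bar>)"
proof (rule Bochner_Integration.integrable_bound)
  show "integrable M (\<lambda>x. norm (F x) powr P / (P / a) + norm (G x) powr (P / (P - a)) / (P / (P - a)))"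
    using F(2) G(2) by (intro Bochner_Integration.integrable_add integrable_divide_zero) auto
  show "(\<lambda>x. norm (F x) powr a * \<bar>G x\<bar>) \<in> borel_measurable M"
    using F(1) G(1) by measurable
  have "norm (F x) powr a * \<bar>G x\<bar> \<le> norm (F x) powr P / (P / a) + norm (G x) powr (P / (P - a)) / (P / (P - a))" for x
    using Youngs_inequality[of "P / a" "P / (P - a)" "norm (F x) powr a" "\<bar>G x\<bar>"] a
    by (simp add: powr_powr field_simps)
  then show "AE x in M. norm (norm (F x) powr a * \<bar>G x\<bar>)
      \<le> norm (norm (F x) powr P / (P / a) + norm (G x) powr (P / (P - a)) / (P / (P - a)))"
    by (intro AE_I2) (smt (verit) abs_ge_zero mult_nonneg_nonneg powr_ge_zero real_norm_def)
qed

lemma Holder_powr_mult: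
  fixes F :: "'a \<Rightarrow> 'b::{real_normed_vector}" and G :: "'a \<Rightarrow> real"
  assumes a: "0 < a" "a < P"
    and F: "(\<lambda>x. norm (F x)) \<in> borel_measurable M" "integrable M (\<lambda>x. norm (F x) powr P)"
    and G: "G \<in> borel_measurable M" "integrable M (\<lambda>x. norm (G x) powr (P / (P - a)))"
  shows "(LINT x|M. norm (F x) powr a * \<bar>G x\<bar>) \<le> lp_norm M P F powr a * lp_norm M (P / (P - a)) G"
proof -
  let ?t = "P / (P - a)"
  let ?A = "lp_norm M P F powr a" and ?B = "lp_norm M ?t G"
  have t: "1 < P / a" "1 < ?t" "1 / (P / a) + 1 / ?t = 1"
    using a by (auto simp: field_simps)
  show ?thesis
  \<comment> \<open>The main case divides by both norms. If one of them is 0, the integrand vanishes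
    almost everywhere.\<close>
  proof (cases "?A = 0 \<or> ?B = 0")
    case True
    then have "(AE x in M. F x = 0) \<or> (AE x in M. G x = 0)"
      using lp_norm_eq_0_iff_AE[OF F(2)] lp_norm_eq_0_iff_AE[OF G(2)] by auto
    then have "AE x in M. norm (F x) powr a * \<bar>G x\<bar> = 0"
    proof
      assume "AE x in M. F x = 0"
      then show ?thesis by eventually_elim simp
    next
      assume "AE x in M. G x = 0"
      then show ?thesis by eventually_elim simp
    qed
    then have "(LINT x|M. norm (F x) powr a * \<bar>G x\<bar>) = 0"
      by (rule integral_eq_zero_AE)
    then show ?thesis
      by simp
  next
    case False
    then have AB: "0 < ?A" "0 < ?B"
      by (auto simp: less_le)
    have A: "?A powr (P / a) = (LINT x|M. norm (F x) powr P)"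
      using a by (simp add: powr_powr lp_norm_powr)
    have B: "?B powr ?t = (LINT x|M. norm (G x) powr ?t)"
      using t by (intro lp_norm_powr) simp
    \<comment> \<open>Young's inequality for the normalised factors: the two terms integrate to the
      reciprocals of the exponents, which add up to 1.\<close>
    let ?R = "\<lambda>x. norm (F x) powr P / ?A powr (P / a) / (P / a) + norm (G x) powr ?t / ?B powr ?t / ?t"
    have "norm (F x) powr a * \<bar>G x\<bar> / (?A * ?B) \<le> ?R x" for x
      using Youngs_inequality[OF t, of "norm (F x) powr a / ?A" "\<bar>G x\<bar> / ?B"] a AB
      by (simp add: powr_powr powr_divide)
    moreover have R: "integrable M ?R"
      by (intro Bochner_Integration.integrable_add integrable_divide_zero) (use F(2) G(2) in auto)
    moreover have "integrable M (\<lambda>x. norm (F x) powr a * \<bar>G x\<bar> / (?A * ?B))"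
      by (intro integrable_divide_zero integrable_powr_mult[OF a F G])
    ultimately have "(LINT x|M. norm (F x) powr a * \<bar>G x\<bar> / (?A * ?B)) \<le> (LINT x|M. ?R x)"
      by (intro integral_mono) auto
    also have "(LINT x|M. ?R x) = (LINT x|M. norm (F x) powr P) / ?A powr (P / a) / (P / a)
        + (LINT x|M. norm (G x) powr ?t) / ?B powr ?t / ?t"
      using F(2) G(2) by (simp del: real_norm_def)
    also have "\<dots> = 1 / (P / a) + 1 / ?t"
      unfolding A[symmetric] B[symmetric] using AB by simp
    finally show ?thesis
      using AB t(3) by (simp add: pos_divide_le_eq)
  qed
qed

text \<open>Absolute continuity of the integral along decreasing sets with null intersection, the
  form in which \<open>Vitali_convergence\<close> asks for smallness.\<close>

lemma lp_norm_shrinking_tendsto_0: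
  fixes G :: "'a \<Rightarrow> real"
  assumes t: "0 < t" and G: "G \<in> borel_measurable M" "integrable M (\<lambda>x. norm (G x) powr t)"
    and E: "\<And>m. E m \<in> sets M" "decseq E" "AE x in M. x \<notin> (\<Inter>m. E m)"
  shows "(\<lambda>m. lp_norm M t (\<lambda>x. indicator (E m) x * G x)) \<longlonglongrightarrow> 0"
proof -
  have "(\<lambda>m. LINT x|M. norm (indicator (E m) x * G x) powr t) \<longlonglongrightarrow> (LINT x|M. 0)"
  proof (rule integral_dominated_convergence)
    show "AE x in M. (\<lambda>m. norm (indicator (E m) x * G x) powr t) \<longlonglongrightarrow> 0"
      using E(3)
    proof eventually_elim
      case (elim x)
      then obtain N where "x \<notin> E N" by auto
      then have "\<And>m. m \<ge> N \<Longrightarrow> norm (indicator (E m) x * G x) powr t = 0"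
        using E(2) by (auto simp: decseq_def indicator_def)
      then show ?case
        by (intro tendsto_eventually) (auto simp: eventually_sequentially)
    qed
    show "AE x in M. norm (norm (indicator (E m) x * G x) powr t) \<le> norm (G x) powr t" for m
      by (auto simp: indicator_def)
    show "(\<lambda>x. norm (indicator (E m) x * G x) powr t) \<in> borel_measurable M" for m
      using G(1) E(1)[of m] by measurable
  qed (use G in auto)
  then have "(\<lambda>m. (LINT x|M. norm (indicator (E m) x * G x) powr t) powr (1 / t)) \<longlonglongrightarrow> 0"
    using t by (intro tendsto_zero_powrI[where b = "1 / t"]) auto
  then show ?thesis
    by (simp add: lp_norm_def)
qed

text \<open>
  Off the set where some later \<open>w k\<close> is at distance more than 1 from the limit, dominated
  convergence applies because the measure is finite; on that shrinking set the integrals are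
  uniformly small.
\<close>

lemma Vitali_convergence:
  fixes w :: "nat \<Rightarrow> 'a \<Rightarrow> real"
  assumes "finite_measure M" and w: "\<And>k. integrable M (w k)" "integrable M w'"
    and lim: "AE x in M. (\<lambda>k. w k x) \<longlonglongrightarrow> w' x"
    and small: "\<And>E \<epsilon>. \<lbrakk>\<And>m. E m \<in> sets M; decseq E; AE x in M. x \<notin> (\<Inter>m. E m); 0 < \<epsilon>\<rbrakk>
      \<Longrightarrow> \<exists>m. \<forall>k. (LINT x|M. indicator (E m) x * \<bar>w k x\<bar>) \<le> \<epsilon>"
  shows "(\<lambda>k. LINT x|M. w k x) \<longlonglongrightarrow> (LINT x|M. w' x)"
proof (rule LIMSEQ_I)
  fix \<epsilon> :: real assume \<epsilon>: "0 < \<epsilon>"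
  interpret finite_measure M by fact
  have [measurable]: "w k \<in> borel_measurable M" "w' \<in> borel_measurable M" for k
    using w by (auto intro: borel_measurable_integrable)
  define E where "E m = {x \<in> space M. \<exists>k\<ge>m. \<bar>w k x - w' x\<bar> > 1}" for m
  have E: "E m \<in> sets M" for m
    unfolding E_def by measurable
  have dec: "decseq E"
    by (auto simp: decseq_def E_def) (meson le_trans)
  have null: "AE x in M. x \<notin> (\<Inter>m. E m)"
    using lim
  proof eventually_elim
    case (elim x)
    then obtain N where "\<And>k. k \<ge> N \<Longrightarrow> norm (w k x - w' x) < 1"
      using LIMSEQ_D[of "\<lambda>k. w k x" "w' x" 1] by auto
    then have "x \<notin> E N"
      by (auto simp: E_def not_less less_imp_le)
    then show ?case by blast
  qed
  have int: "integrable M (\<lambda>x. indicator (E m) x * \<bar>g x\<bar>)" if "integrable M g" for m and g :: "'a \<Rightarrow> real"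
    using integrable_mult_indicator[OF E[of m] integrable_abs[OF that]] by simp
  have "(\<lambda>m. lp_norm M 1 (\<lambda>x. indicator (E m) x * w' x)) \<longlonglongrightarrow> 0"
    using w(2) by (intro lp_norm_shrinking_tendsto_0 E dec null) auto
  then have "(\<lambda>m. LINT x|M. indicator (E m) x * \<bar>w' x\<bar>) \<longlonglongrightarrow> 0"
    by (simp add: lp_norm_def abs_mult)
  then obtain m1 where m1: "(LINT x|M. indicator (E m) x * \<bar>w' x\<bar>) < \<epsilon> / 4" if "m \<ge> m1" for m
    using order_tendstoD(2)[of _ 0 sequentially "\<epsilon> / 4"] \<epsilon> by (auto simp: eventually_sequentially)
  obtain m2 where m2: "(LINT x|M. indicator (E m2) x * \<bar>w k x\<bar>) \<le> \<epsilon> / 4" for k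
    using small[OF E dec null, of "\<epsilon> / 4"] \<epsilon> by auto
  \<comment> \<open>\<open>small\<close> gives a bound at the single index m2, uniform in k. As E
    decreases, it persists at the larger index m, where w' is controlled too.\<close>
  define m where "m = max m1 m2"
  have E2: "(LINT x|M. indicator (E m) x * \<bar>w k x\<bar>) \<le> \<epsilon> / 4" for k
  proof -
    have "E m \<subseteq> E m2"
      using dec by (rule decseqD) (simp add: m_def)
    then have "(LINT x|M. indicator (E m) x * \<bar>w k x\<bar>) \<le> (LINT x|M. indicator (E m2) x * \<bar>w k x\<bar>)"
      by (intro integral_mono int w) (auto simp: indicator_def)
    with m2[of k] show ?thesis by linarith
  qed
  \<comment> \<open>Shifting the index by m makes the bound 1 off \<open>E m\<close> valid for every
    k, as domination requires.\<close>
  let ?d = "\<lambda>k x. indicator (space M - E m) x * \<bar>w (k + m) x - w' x\<bar>"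
  have "(\<lambda>k. LINT x|M. ?d k x) \<longlonglongrightarrow> (LINT x|M. 0)"
  proof (rule integral_dominated_convergence)
    show "AE x in M. (\<lambda>k. ?d k x) \<longlonglongrightarrow> 0"
      using lim
    proof eventually_elim
      case (elim x)
      then have "(\<lambda>k. w (k + m) x) \<longlonglongrightarrow> w' x"
        by (rule LIMSEQ_ignore_initial_segment)
      then have "(\<lambda>k. \<bar>w (k + m) x - w' x\<bar>) \<longlonglongrightarrow> 0"
        by (simp add: LIM_zero tendsto_rabs_zero)
      then show ?case
        by (rule tendsto_mult_right_zero)
    qed
    show "AE x in M. norm (?d k x) \<le> 1" for k
      by (auto simp: E_def indicator_def not_less)
    show "?d k \<in> borel_measurable M" for k
      using E[of m] by measurable
  qed simp_all
  then obtain N where N: "(LINT x|M. ?d k x) < \<epsilon> / 4" if "k \<ge> N" for k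
    using order_tendstoD(2)[of _ 0 sequentially "\<epsilon> / 4"] \<epsilon> by (auto simp: eventually_sequentially)
  show "\<exists>N. \<forall>k\<ge>N. norm ((LINT x|M. w k x) - (LINT x|M. w' x)) < \<epsilon>"
  proof (intro exI allI impI)
    fix k assume k: "N + m \<le> k"
    define j where "j = k - m"
    have j: "k = j + m" "N \<le> j"
      using k by (auto simp: j_def)
    have d: "integrable M (?d j)"
      using integrable_mult_indicator[of "space M - E m" M "\<lambda>x. \<bar>w (j + m) x - w' x\<bar>"] E[of m] w by auto
    have "norm ((LINT x|M. w k x) - (LINT x|M. w' x)) = \<bar>LINT x|M. w k x - w' x\<bar>"
      using w by simp
    also have "\<dots> \<le> (LINT x|M. \<bar>w k x - w' x\<bar>)"
      by (rule integral_abs_bound)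
    also have "\<dots> \<le> (LINT x|M. ?d j x + indicator (E m) x * \<bar>w k x\<bar> + indicator (E m) x * \<bar>w' x\<bar>)"
    proof (rule integral_mono)
      show "integrable M (\<lambda>x. \<bar>w k x - w' x\<bar>)"
        using w by simp
      show "integrable M (\<lambda>x. ?d j x + indicator (E m) x * \<bar>w k x\<bar> + indicator (E m) x * \<bar>w' x\<bar>)"
        by (intro Bochner_Integration.integrable_add d int w)
    qed (auto simp: indicator_def j)
    also have "\<dots> = (LINT x|M. ?d j x) + (LINT x|M. indicator (E m) x * \<bar>w k x\<bar>)
        + (LINT x|M. indicator (E m) x * \<bar>w' x\<bar>)"
      using d int[OF w(1)] int[OF w(2)] by simp
    also have "\<dots> < \<epsilon>"
      using N[OF j(2)] E2[of k] m1[of m] \<epsilon> by (simp add: m_def)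
    finally show "norm ((LINT x|M. w k x) - (LINT x|M. w' x)) < \<epsilon>" .
  qed
qed

section \<open>Extended norms and real norms\<close>

lemma LspaceD:
  fixes u :: "'a::euclidean_space \<Rightarrow> 'b::{real_normed_vector}"
  assumes r: "0 < r" and u: "u \<in> Lspace \<Omega> (ereal r)" and m: "(\<lambda>x. norm (u x)) \<in> borel_measurable (lebesgue_on \<Omega>)"
  shows "integrable (lebesgue_on \<Omega>) (\<lambda>x. norm (u x) powr r)"
    and "Lnorm \<Omega> (ereal r) u = ennreal (lp_norm (lebesgue_on \<Omega>) r u)"
proof -
  let ?I = "\<integral>\<^sup>+x. ennreal (norm (u x) powr r) \<partial>lebesgue_on \<Omega>"
  have L: "Lnorm \<Omega> (ereal r) u = epowr ?I (1 / r)"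
    by (simp add: Lnorm_def)
  then have fin: "?I < \<infinity>"
    using u by (auto simp: Lspace_def epowr_def less_top split: if_splits)
  \<comment> \<open>Integrability has to come first: without it \<open>lp_norm\<close> takes the
    default value 0 and says nothing about the norm.\<close>
  then show int: "integrable (lebesgue_on \<Omega>) (\<lambda>x. norm (u x) powr r)"
    using m by (intro integrableI_nonneg) auto
  have "?I = ennreal (LINT x|lebesgue_on \<Omega>. norm (u x) powr r)"
    using int by (intro nn_integral_eq_integral) auto
  then show "Lnorm \<Omega> (ereal r) u = ennreal (lp_norm (lebesgue_on \<Omega>) r u)"
    using L by (simp add: epowr_def lp_norm_def)
qed

lemma LspaceI:
  fixes u :: "'a::euclidean_space \<Rightarrow> 'b::real_normed_vector"
  assumes "u \<in> borel_measurable (lebesgue_on \<Omega>)" "integrable (lebesgue_on \<Omega>) (\<lambda>x. norm (u x) powr r)"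
  shows "u \<in> Lspace \<Omega> (ereal r)"
proof -
  have "(\<integral>\<^sup>+x. ennreal (norm (u x) powr r) \<partial>lebesgue_on \<Omega>) < \<infinity>"
    using assms(2) by (simp add: nn_integral_eq_integral)
  then show ?thesis
    using assms(1) by (auto simp: Lspace_def Lnorm_def epowr_def less_top)
qed

lemma epowr_ennreal: "0 \<le> x \<Longrightarrow> epowr (ennreal x) a = ennreal (x powr a)"
  by (simp add: epowr_def)

section \<open>Sobolev functions and superposition operators\<close>

text \<open>Simple approximations of s and \<xi> take finitely many values, so measurability in x at
  fixed arguments settles them. Continuity in the arguments carries this to the limit almost
  everywhere, and completeness of the measure disposes of the exceptional set.\<close>

lemma caratheodory_compose_measurable:
  fixes f :: "'a::euclidean_space \<Rightarrow> real \<Rightarrow> 'a \<Rightarrow> real"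
  assumes \<Omega>: "\<Omega> \<in> sets lebesgue" and f: "caratheodory \<Omega> f"
    and s: "s \<in> borel_measurable (lebesgue_on \<Omega>)" and \<xi>: "\<xi> \<in> borel_measurable (lebesgue_on \<Omega>)"
  shows "(\<lambda>x. f x (s x) (\<xi> x)) \<in> borel_measurable (lebesgue_on \<Omega>)"
proof -
  let ?M = "lebesgue_on \<Omega>"
  have "(\<lambda>x. (s x, \<xi> x)) \<in> borel_measurable ?M"
    using s \<xi> by (rule borel_measurable_Pair)
  from borel_measurable_implies_sequence_metric[OF this, of "(0, 0)"]
  obtain F where F: "\<And>i. simple_function ?M (F i)"
    and lim: "\<And>x. x \<in> space ?M \<Longrightarrow> (\<lambda>i. F i x) \<longlonglongrightarrow> (s x, \<xi> x)"
    by blast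
  have meas: "(\<lambda>x. f x (fst (F i x)) (snd (F i x))) \<in> borel_measurable ?M" for i
  proof (rule measurable_compose_countable'[where g = "F i" and I = "F i ` space ?M"])
    show "(\<lambda>x. f x (fst y) (snd y)) \<in> borel_measurable ?M" for y
      using f by (simp add: caratheodory_def)
    show "F i \<in> measurable ?M (count_space (F i ` space ?M))"
      using F[of i] by (subst measurable_count_space_eq2) (auto simp: simple_function_def)
    show "countable (F i ` space ?M)"
      using F[of i] by (auto simp: simple_function_def intro: countable_finite)
  qed
  have "AE x in ?M. (\<lambda>i. f x (fst (F i x)) (snd (F i x))) \<longlonglongrightarrow> f x (s x) (\<xi> x)"
  proof -
    have "AE x in ?M. continuous_on UNIV (\<lambda>(s, \<xi>). f x s \<xi>)"
      using f by (simp add: caratheodory_def)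
    then show ?thesis
      using AE_space
    proof eventually_elim
      case (elim x)
      then have "isCont (\<lambda>(s, \<xi>). f x s \<xi>) (s x, \<xi> x)"
        by (simp add: continuous_on_eq_continuous_at)
      from isCont_tendsto_compose[OF this lim[OF elim(2)]] show ?case
        by (simp add: case_prod_beta)
    qed
  qed
  then have "AE x in ?M. lim (\<lambda>i. f x (fst (F i x)) (snd (F i x))) = f x (s x) (\<xi> x)"
    by eventually_elim (rule limI)
  then show ?thesis
    by (rule borel_measurable_lebesgue_on_cong_AE[OF \<Omega> borel_measurable_lim_metric[OF meas]])
qed

lemma integrable_norm_powr_lincomb:
  fixes u v :: "'a \<Rightarrow> 'b::{real_normed_vector, second_countable_topology}"
  assumes p: "0 \<le> p"
    and u: "u \<in> borel_measurable M" "integrable M (\<lambda>x. norm (u x) powr p)"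
    and v: "v \<in> borel_measurable M" "integrable M (\<lambda>x. norm (v x) powr p)"
  shows "integrable M (\<lambda>x. norm (a *\<^sub>R u x + b *\<^sub>R v x) powr p)"
proof (rule Bochner_Integration.integrable_bound)
  let ?R = "\<lambda>x. (2 * \<bar>a\<bar>) powr p * norm (u x) powr p + (2 * \<bar>b\<bar>) powr p * norm (v x) powr p"
  show "integrable M ?R"
    using u v by (intro Bochner_Integration.integrable_add integrable_mult_right)
  show "(\<lambda>x. norm (a *\<^sub>R u x + b *\<^sub>R v x) powr p) \<in> borel_measurable M"
    using u(1) v(1) by measurable
  have "norm (a *\<^sub>R u x + b *\<^sub>R v x) powr p \<le> ?R x" for x
  proof -
    \<comment> \<open>The power of the maximum is one of the two powers, hence at most their
      sum.\<close>
    have "norm (a *\<^sub>R u x + b *\<^sub>R v x) \<le> 2 * max (\<bar>a\<bar> * norm (u x)) (\<bar>b\<bar> * norm (v x))"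
      using norm_triangle_ineq[of "a *\<^sub>R u x" "b *\<^sub>R v x"] by simp
    then have "norm (a *\<^sub>R u x + b *\<^sub>R v x) powr p \<le> (2 * max (\<bar>a\<bar> * norm (u x)) (\<bar>b\<bar> * norm (v x))) powr p"
      using p by (intro powr_mono2) auto
    also have "\<dots> \<le> (2 * (\<bar>a\<bar> * norm (u x))) powr p + (2 * (\<bar>b\<bar> * norm (v x))) powr p"
      by (auto simp: max_def)
    also have "\<dots> = ?R x"
      by (simp add: powr_mult mult.assoc)
    finally show ?thesis .
  qed
  then show "AE x in M. norm (norm (a *\<^sub>R u x + b *\<^sub>R v x) powr p) \<le> norm (?R x)"
    by (intro AE_I2) (smt (verit) real_norm_def powr_ge_zero)
qed

text \<open>Membership provides only some gradient g in L^p; uniqueness up to null sets passes its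
  measurability and integrability on to the chosen \<open>grad\<close>. From here on norms are real
  numbers.\<close>

lemma sobolevD:
  fixes u :: "'a::euclidean_space \<Rightarrow> real"
  assumes \<Omega>: "open \<Omega>" and p: "0 < p" and u: "u \<in> sobolev \<Omega> p"
  shows "weak_gradient \<Omega> u (grad \<Omega> u)"
    and "u \<in> borel_measurable (lebesgue_on \<Omega>)" "grad \<Omega> u \<in> borel_measurable (lebesgue_on \<Omega>)"
    and "integrable (lebesgue_on \<Omega>) (\<lambda>x. norm (u x) powr p)"
    and "integrable (lebesgue_on \<Omega>) (\<lambda>x. norm (grad \<Omega> u x) powr p)"
    and "Lnorm \<Omega> (ereal p) u = ennreal (lp_norm (lebesgue_on \<Omega>) p u)"
    and "Lnorm \<Omega> (ereal p) (grad \<Omega> u) = ennreal (lp_norm (lebesgue_on \<Omega>) p (grad \<Omega> u))"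
proof -
  obtain g where g: "g \<in> Lspace \<Omega> p" "weak_gradient \<Omega> u g"
    using u by (auto simp: sobolev_def)
  show "weak_gradient \<Omega> u (grad \<Omega> u)"
    using g(2) by (rule weak_gradient_grad)
  have uL: "u \<in> Lspace \<Omega> p"
    using u by (simp add: sobolev_def)
  then show um: "u \<in> borel_measurable (lebesgue_on \<Omega>)"
    by (simp add: Lspace_def)
  have gm: "g \<in> borel_measurable (lebesgue_on \<Omega>)"
    using g(1) by (simp add: Lspace_def)
  have ae: "AE x in lebesgue_on \<Omega>. grad \<Omega> u x = g x"
    by (rule grad_eq_AE[OF \<Omega> g(2)])
  then have "AE x in lebesgue_on \<Omega>. g x = grad \<Omega> u x"
    by eventually_elim simp
  then show gradm: "grad \<Omega> u \<in> borel_measurable (lebesgue_on \<Omega>)"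
    using \<Omega> by (intro borel_measurable_lebesgue_on_cong_AE[OF _ gm]) auto
  have norm_meas: "(\<lambda>x. norm (u x)) \<in> borel_measurable (lebesgue_on \<Omega>)"
    "(\<lambda>x. norm (g x)) \<in> borel_measurable (lebesgue_on \<Omega>)"
    "(\<lambda>x. norm (grad \<Omega> u x)) \<in> borel_measurable (lebesgue_on \<Omega>)"
    using um gm gradm by simp_all
  show "integrable (lebesgue_on \<Omega>) (\<lambda>x. norm (u x) powr p)"
    "Lnorm \<Omega> (ereal p) u = ennreal (lp_norm (lebesgue_on \<Omega>) p u)"
    using LspaceD[OF p uL norm_meas(1)] by auto
  have "AE x in lebesgue_on \<Omega>. norm (g x) powr p = norm (grad \<Omega> u x) powr p"
    using ae by eventually_elim simp
  then show int: "integrable (lebesgue_on \<Omega>) (\<lambda>x. norm (grad \<Omega> u x) powr p)"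
    using gm gradm LspaceD(1)[OF p g(1) norm_meas(2)]
    by (subst (asm) integrable_cong_AE) auto
  show "Lnorm \<Omega> (ereal p) (grad \<Omega> u) = ennreal (lp_norm (lebesgue_on \<Omega>) p (grad \<Omega> u))"
    by (rule LspaceD(2)[OF p LspaceI[OF gradm int] norm_meas(3)])
qed

lemma sobolev_diff:
  fixes u v :: "'a::euclidean_space \<Rightarrow> real"
  assumes \<Omega>: "open \<Omega>" and p: "0 < p" and u: "u \<in> sobolev \<Omega> p" and v: "v \<in> sobolev \<Omega> p"
  shows "(\<lambda>x. u x - v x) \<in> sobolev \<Omega> p"
proof -
  note u = sobolevD[OF \<Omega> p u] and v = sobolevD[OF \<Omega> p v]
  have "weak_gradient \<Omega> (\<lambda>x. u x - v x) (\<lambda>x. grad \<Omega> u x - grad \<Omega> v x)"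
    using weak_gradient_lincomb[OF \<Omega> u(1) v(1), of 1 "-1"] by simp
  moreover have "(\<lambda>x. u x - v x) \<in> Lspace \<Omega> p"
    using u(2) v(2) integrable_norm_powr_lincomb[OF less_imp_le[OF p] u(2,4) v(2,4), of 1 "-1"]
    by (intro LspaceI) simp_all
  moreover have "(\<lambda>x. grad \<Omega> u x - grad \<Omega> v x) \<in> Lspace \<Omega> p"
    using u(3) v(3) integrable_norm_powr_lincomb[OF less_imp_le[OF p] u(3,5) v(3,5), of 1 "-1"]
    by (intro LspaceI) simp_all
  ultimately show ?thesis
    by (auto simp: sobolev_def)
qed

lemma tendsto_0_norm_powr_sum:
  fixes x :: "nat \<Rightarrow> 'a::real_normed_vector"
  assumes p: "0 < p" and lim: "(\<lambda>k. norm (x k) powr p + y k) \<longlonglongrightarrow> 0" and y: "\<And>k. 0 \<le> y k"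
  shows "x \<longlonglongrightarrow> 0"
proof -
  have "(\<lambda>k. (norm (x k) powr p + y k) powr (1 / p)) \<longlonglongrightarrow> 0"
    using p y by (intro tendsto_zero_powrI[OF lim, where b = "1 / p"]) auto
  moreover have "norm (x k) \<le> (norm (x k) powr p + y k) powr (1 / p)" for k
  proof -
    have "norm (x k) = (norm (x k) powr p) powr (1 / p)"
      using p by (simp add: powr_powr)
    also have "\<dots> \<le> (norm (x k) powr p + y k) powr (1 / p)"
      using p y by (intro powr_mono2) auto
    finally show ?thesis .
  qed
  ultimately show ?thesis
    by (intro Lim_null_comparison[where f = x and g = "\<lambda>k. (norm (x k) powr p + y k) powr (1 / p)"]) auto
qed

text \<open>Norm convergence yields almost everywhere convergence only along a subsequence. Adding
  the p-th powers of the differences and of their gradients gives one sequence tending to 0 in L^1,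
  so a single subsequence serves both.\<close>

lemma continuous_sobolev_map_subseq:
  fixes u :: "nat \<Rightarrow> 'a::euclidean_space \<Rightarrow> real"
  assumes \<Omega>: "open \<Omega>" and p: "0 < p" and T: "continuous_sobolev_map \<Omega> p T"
    and u: "\<And>k. u k \<in> sobolev0 \<Omega> p" and w: "w \<in> sobolev0 \<Omega> p"
    and lim: "(\<lambda>k. lp_norm (lebesgue_on \<Omega>) p (grad \<Omega> (\<lambda>x. u k x - w x))) \<longlonglongrightarrow> 0"
  obtains r :: "nat \<Rightarrow> nat" where "strict_mono r"
    "AE x in lebesgue_on \<Omega>. (\<lambda>k. T (u (r k)) x) \<longlonglongrightarrow> T w x"
    "AE x in lebesgue_on \<Omega>. (\<lambda>k. grad \<Omega> (T (u (r k))) x) \<longlonglongrightarrow> grad \<Omega> (T w) x"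
proof -
  let ?M = "lebesgue_on \<Omega>"
  let ?D = "\<lambda>k x. T (u k) x - T w x"
  have us: "u k \<in> sobolev \<Omega> p" and ws: "w \<in> sobolev \<Omega> p" for k
    using u w by (auto simp: sobolev0_def)
  have Tu: "T (u k) \<in> sobolev \<Omega> p" and Tw: "T w \<in> sobolev \<Omega> p" for k
    using T u w by (auto simp: continuous_sobolev_map_def)
  note D = sobolevD[OF \<Omega> p sobolev_diff[OF \<Omega> p Tu Tw]]
  have small: "sobolev0_norm \<Omega> p (\<lambda>x. u k x - w x) = ennreal (lp_norm ?M p (grad \<Omega> (\<lambda>x. u k x - w x)))" for k
    unfolding sobolev0_norm_def by (rule sobolevD(7)[OF \<Omega> p sobolev_diff[OF \<Omega> p us ws]])
  have "(\<lambda>k. sobolev_norm \<Omega> p (?D k)) \<longlonglongrightarrow> 0"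
  proof (rule order_tendstoI)
    fix \<epsilon> :: ennreal assume "0 < \<epsilon>"
    then obtain \<delta> where \<delta>: "0 < \<delta>" "\<And>v. v \<in> sobolev0 \<Omega> p \<Longrightarrow> sobolev0_norm \<Omega> p (\<lambda>x. v x - w x) < \<delta> \<Longrightarrow>
        sobolev_norm \<Omega> p (\<lambda>x. T v x - T w x) < \<epsilon>"
      using T w unfolding continuous_sobolev_map_def by blast
    have "(\<lambda>k. sobolev0_norm \<Omega> p (\<lambda>x. u k x - w x)) \<longlonglongrightarrow> ennreal 0"
      unfolding small using lim by (rule tendsto_ennrealI)
    then have "\<forall>\<^sub>F k in sequentially. sobolev0_norm \<Omega> p (\<lambda>x. u k x - w x) < \<delta>"
      using \<delta>(1) by (intro order_tendstoD) auto
    then show "\<forall>\<^sub>F k in sequentially. sobolev_norm \<Omega> p (?D k) < \<epsilon>"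
      by eventually_elim (intro \<delta>(2) u)
  qed simp
  then have "(\<lambda>k. ennreal (lp_norm ?M p (?D k) + lp_norm ?M p (grad \<Omega> (?D k)))) \<longlonglongrightarrow> ennreal 0"
    by (simp add: sobolev_norm_def D(6,7) ennreal_plus)
  then have sum0: "(\<lambda>k. lp_norm ?M p (?D k) + lp_norm ?M p (grad \<Omega> (?D k))) \<longlonglongrightarrow> 0"
    by (subst (asm) tendsto_ennreal_iff) auto
  have "(\<lambda>k. lp_norm ?M p (?D k)) \<longlonglongrightarrow> 0"
    by (rule tendsto_sandwich[OF _ _ tendsto_const sum0]) auto
  then have 1: "(\<lambda>k. lp_norm ?M p (?D k) powr p) \<longlonglongrightarrow> 0"
    using p by (intro tendsto_zero_powrI[where b = p]) auto
  have "(\<lambda>k. lp_norm ?M p (grad \<Omega> (?D k))) \<longlonglongrightarrow> 0"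
    by (rule tendsto_sandwich[OF _ _ tendsto_const sum0]) auto
  then have 2: "(\<lambda>k. lp_norm ?M p (grad \<Omega> (?D k)) powr p) \<longlonglongrightarrow> 0"
    using p by (intro tendsto_zero_powrI[where b = p]) auto
  let ?h = "\<lambda>k x. norm (?D k x) powr p + norm (grad \<Omega> (?D k) x) powr p"
  have h: "integrable ?M (?h k)" for k
    by (intro Bochner_Integration.integrable_add D)
  have "(\<lambda>k. LINT x|?M. norm (?h k x)) \<longlonglongrightarrow> 0"
  proof -
    have "(LINT x|?M. norm (?h k x)) = lp_norm ?M p (?D k) powr p + lp_norm ?M p (grad \<Omega> (?D k)) powr p" for k
      using p D(4,5)[of k] by (simp add: lp_norm_powr)
    then show ?thesis
      using tendsto_add[OF 1 2] by simp
  qed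
  from tendsto_L1_AE_subseq[OF h this] obtain r :: "nat \<Rightarrow> nat"
    where r: "strict_mono r" and ae: "AE x in ?M. (\<lambda>k. ?h (r k) x) \<longlonglongrightarrow> 0"
    by blast
  \<comment> \<open>\<open>grad\<close> of a difference is a choice of its own; it agrees with the
    difference of the gradients outside one null set common to all k.\<close>
  have "AE x in ?M. \<forall>k. grad \<Omega> (?D k) x = grad \<Omega> (T (u k)) x - grad \<Omega> (T w) x"
    using grad_lincomb_AE[OF \<Omega> sobolevD(1)[OF \<Omega> p Tu] sobolevD(1)[OF \<Omega> p Tw], where a = 1 and b = "-1"]
    by (subst AE_all_countable) simp
  with ae have "AE x in ?M. (\<lambda>k. T (u (r k)) x) \<longlonglongrightarrow> T w x \<and>
      (\<lambda>k. grad \<Omega> (T (u (r k))) x) \<longlonglongrightarrow> grad \<Omega> (T w) x"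
  proof eventually_elim
    case (elim x)
    have lim': "(\<lambda>k. norm (grad \<Omega> (?D (r k)) x) powr p + norm (?D (r k) x) powr p) \<longlonglongrightarrow> 0"
      using elim(1) by (simp only: add.commute)
    have "(\<lambda>k. ?D (r k) x) \<longlonglongrightarrow> 0"
      by (rule tendsto_0_norm_powr_sum[OF p elim(1)]) simp
    moreover have "(\<lambda>k. grad \<Omega> (?D (r k)) x) \<longlonglongrightarrow> 0"
      by (rule tendsto_0_norm_powr_sum[OF p lim']) simp
    ultimately show ?case
      using elim(2) by (simp add: LIM_zero_iff)
  qed
  then show thesis
    using that[OF r] by (simp add: AE_conj_iff)
qed

text \<open>Almost everywhere convergence is at hand only along subsequences; since the integrals
  have the same limit along all of them, the whole sequence of integrals converges.\<close>

lemma tendsto_subseqI: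
  fixes X :: "nat \<Rightarrow> 'a::metric_space"
  assumes "\<And>r :: nat \<Rightarrow> nat. strict_mono r \<Longrightarrow> \<exists>s :: nat \<Rightarrow> nat. strict_mono s \<and> (\<lambda>k. X (r (s k))) \<longlonglongrightarrow> L"
  shows "X \<longlonglongrightarrow> L"
proof (rule ccontr)
  assume "\<not> X \<longlonglongrightarrow> L"
  then obtain \<epsilon> where \<epsilon>: "0 < \<epsilon>" "\<not> (\<forall>\<^sub>F k in sequentially. dist (X k) L < \<epsilon>)"
    by (auto simp: tendsto_iff)
  then have "infinite {k. \<not> dist (X k) L < \<epsilon>}"
    by (simp add: not_eventually frequently_cofinite flip: cofinite_eq_sequentially)
  from infinite_enumerate[OF this]
  obtain r :: "nat \<Rightarrow> nat" where r: "strict_mono r" "\<And>k. \<not> dist (X (r k)) L < \<epsilon>"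
    by auto
  then obtain s :: "nat \<Rightarrow> nat" where "(\<lambda>k. X (r (s k))) \<longlonglongrightarrow> L"
    using assms by blast
  then have "\<forall>\<^sub>F k in sequentially. dist (X (r (s k))) L < \<epsilon>"
    using \<epsilon>(1) by (auto simp: tendsto_iff)
  then show False
    using r(2) by (auto simp: eventually_sequentially)
qed

section \<open>The reaction term\<close>

text \<open>The bound on \<beta> is p divided by the conjugate exponent of \<open>pstar\<close>,
  worked out as p - p/\<open>pstar\<close>.\<close>

locale convective_problem =
  fixes \<Omega> :: "'a::euclidean_space set"
    and p q r \<alpha> \<beta> a1 a2 K1 K2 K3 pstar :: real
    and S :: "real \<Rightarrow> real"
    and T :: "('a \<Rightarrow> real) \<Rightarrow> ('a \<Rightarrow> real)"
    and f :: "'a \<Rightarrow> real \<Rightarrow> 'a \<Rightarrow> real"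
    and \<sigma> :: "'a \<Rightarrow> real"
  assumes open_domain: "open \<Omega>" and bounded_domain: "bounded \<Omega>"
    and exponents: "1 < q" "q < p" "p < pstar"
    and S: "sobolev_constants \<Omega> p pstar S"
    and T: "continuous_sobolev_map \<Omega> p T"
    and f: "caratheodory \<Omega> f"
    and a: "0 \<le> a1" "0 \<le> a2"
    and alpha: "0 < \<alpha>" "\<alpha> < pstar - 1"
    and beta: "0 < \<beta>" "\<beta> < p - p / pstar"
    and r: "1 \<le> r" "r < pstar"
    and sigma: "\<sigma> \<in> Lspace \<Omega> (conj_exponent r)"
    and growth: "AE x in lebesgue_on \<Omega>. \<forall>s \<xi>.
        \<bar>f x s \<xi>\<bar> \<le> \<sigma> x + a1 * \<bar>s\<bar> powr \<alpha> + a2 * norm \<xi> powr \<beta>"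
    and K: "0 \<le> K1" "0 \<le> K2" "0 \<le> K3"
    and small: "a1 * K1 * S (pstar / (pstar - \<alpha>)) + a2 * K2 * S (p / (p - \<beta>)) < 1"
    and T_bound: "\<And>u. u \<in> sobolev0 \<Omega> p \<Longrightarrow>
        epowr (Lnorm \<Omega> pstar (T u)) \<alpha>
          \<le> ennreal K1 * epowr (Lnorm \<Omega> p (grad \<Omega> u)) (p - 1) + ennreal K3"
    and grad_T_bound: "\<And>u. u \<in> sobolev0 \<Omega> p \<Longrightarrow>
        epowr (Lnorm \<Omega> p (grad \<Omega> (T u))) \<beta>
          \<le> ennreal K2 * epowr (Lnorm \<Omega> p (grad \<Omega> u)) (p - 1) + ennreal K3"
begin

abbreviation M where "M \<equiv> lebesgue_on \<Omega>"
abbreviation nrm where "nrm u \<equiv> lp_norm M p (grad \<Omega> u)"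
abbreviation W where "W \<equiv> sobolev0 \<Omega> p"
text \<open>The conjugates of \<open>pstar\<close>/\<alpha> and p/\<beta>: in these norms the test
  function is paired with the powers of T u and of its gradient.\<close>

abbreviation s1 where "s1 \<equiv> pstar / (pstar - \<alpha>)"
abbreviation s2 where "s2 \<equiv> p / (p - \<beta>)"

definition reaction :: "('a \<Rightarrow> real) \<Rightarrow> 'a \<Rightarrow> real" where
  "reaction u x = f x (T u x) (grad \<Omega> (T u) x)"

lemma finite_measure_M: "finite_measure M"
  using open_domain bounded_domain
  by (intro finite_measure_lebesgue_on bounded_set_imp_lmeasurable) auto

lemma sets_domain: "\<Omega> \<in> sets lebesgue"
  using open_domain by auto

text \<open>The upper bounds on \<alpha> and \<beta> do their work here:
  \<open>s1 \<le> pstar\<close> amounts to \<open>1 \<le> pstar - \<alpha>\<close>, and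
  \<open>s2 \<le> pstar\<close> to \<open>\<beta> \<le> p - p / pstar\<close>.\<close>

lemma exponent_ranges:
  "0 < p" "1 < p" "0 < pstar" "\<alpha> < pstar" "\<beta> < p" "s1 \<in> {1..pstar}" "s2 \<in> {1..pstar}" "r \<in> {1..pstar}"
proof -
  show p: "0 < p" "1 < p" "0 < pstar" "\<alpha> < pstar" "r \<in> {1..pstar}"
    using exponents alpha r by auto
  have pp: "0 < p / pstar"
    using p by simp
  then show "\<beta> < p"
    using beta by linarith
  have "pstar * 1 \<le> pstar * (pstar - \<alpha>)"
    using alpha p by (intro mult_left_mono) auto
  then show "s1 \<in> {1..pstar}"
    using alpha p by (auto simp: divide_le_eq)
  have "p < pstar * (p - \<beta>)"
    using beta p by (auto simp: field_simps)
  then show "s2 \<in> {1..pstar}"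
    using beta \<open>\<beta> < p\<close> by (auto simp: divide_le_eq)
qed

lemma S_pos: "s \<in> {1..pstar} \<Longrightarrow> 0 < S s"
  using S by (auto simp: sobolev_constants_def)

lemma W_sobolev: "u \<in> W \<Longrightarrow> u \<in> sobolev \<Omega> p"
  by (simp add: sobolev0_def)

lemmas W_D = sobolevD[OF open_domain exponent_ranges(1) W_sobolev]

lemma T_sobolev: "u \<in> W \<Longrightarrow> T u \<in> sobolev \<Omega> p"
  using T by (auto simp: continuous_sobolev_map_def)

lemmas T_D = sobolevD[OF open_domain exponent_ranges(1) T_sobolev]

lemma Sobolev_embedding:
  assumes u: "u \<in> W" and s: "s \<in> {1..pstar}"
  shows "integrable M (\<lambda>x. norm (u x) powr s)" "lp_norm M s u \<le> S s * nrm u"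
proof -
  have le: "Lnorm \<Omega> s u \<le> ennreal (S s) * ennreal (nrm u)"
    using S u s unfolding sobolev_constants_def W_D(7)[OF u, symmetric] by blast
  then have "Lnorm \<Omega> s u < \<infinity>"
    by (rule le_less_trans) (simp add: ennreal_mult_less_top)
  then have L: "u \<in> Lspace \<Omega> s"
    using W_D(2)[OF u] by (simp add: Lspace_def)
  have s0: "0 < s"
    using s by auto
  have m: "(\<lambda>x. norm (u x)) \<in> borel_measurable M"
    using W_D(2)[OF u] by simp
  show "integrable M (\<lambda>x. norm (u x) powr s)"
    by (rule LspaceD(1)[OF s0 L m])
  show "lp_norm M s u \<le> S s * nrm u"
    using le S_pos[OF s] unfolding LspaceD(2)[OF s0 L m]
    by (simp flip: ennreal_mult')
qed

lemma epowr_finite_imp_finite: "epowr x b < \<infinity> \<Longrightarrow> x < \<infinity>"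
  by (auto simp: epowr_def less_top split: if_splits)

text \<open>T u lies in the full Sobolev space, whereas the constants S speak about functions with
  zero boundary values. That T u has a finite norm of exponent \<open>pstar\<close> is read off
  \<open>T_bound\<close>, whose right-hand side is finite.\<close>

lemma T_estimate:
  assumes u: "u \<in> W"
  shows "integrable M (\<lambda>x. norm (T u x) powr pstar)"
    and "lp_norm M pstar (T u) powr \<alpha> \<le> K1 * nrm u powr (p - 1) + K3"
    and "nrm (T u) powr \<beta> \<le> K2 * nrm u powr (p - 1) + K3"
proof -
  have rhs: "ennreal k * epowr (Lnorm \<Omega> p (grad \<Omega> u)) (p - 1) + ennreal K3
      = ennreal (k * nrm u powr (p - 1) + K3)" if "0 \<le> k" for k
    using that K(3) W_D(7)[OF u] by (simp add: epowr_ennreal ennreal_mult' ennreal_plus)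
  have le: "epowr (Lnorm \<Omega> pstar (T u)) \<alpha> \<le> ennreal (K1 * nrm u powr (p - 1) + K3)"
    using T_bound[OF u] rhs[OF K(1)] by simp
  then have "epowr (Lnorm \<Omega> pstar (T u)) \<alpha> < \<infinity>"
    by (rule le_less_trans) simp
  then have "Lnorm \<Omega> pstar (T u) < \<infinity>"
    by (rule epowr_finite_imp_finite)
  then have L: "T u \<in> Lspace \<Omega> pstar"
    using T_D(2)[OF u] by (simp add: Lspace_def)
  have m: "(\<lambda>x. norm (T u x)) \<in> borel_measurable M"
    using T_D(2)[OF u] by simp
  note D = LspaceD[OF exponent_ranges(3) L m]
  show "integrable M (\<lambda>x. norm (T u x) powr pstar)"
    by (rule D(1))
  show "lp_norm M pstar (T u) powr \<alpha> \<le> K1 * nrm u powr (p - 1) + K3"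
    using le K unfolding D(2) epowr_ennreal[OF lp_norm_nonneg] by (subst (asm) ennreal_le_iff) auto
  show "nrm (T u) powr \<beta> \<le> K2 * nrm u powr (p - 1) + K3"
    using grad_T_bound[OF u] K unfolding rhs[OF K(2)] T_D(7)[OF u] epowr_ennreal[OF lp_norm_nonneg]
    by (subst (asm) ennreal_le_iff) auto
qed

lemma sigma_measurable: "\<sigma> \<in> borel_measurable M"
  using sigma by (simp add: Lspace_def)

text \<open>Hoelder and the embedding into L^r, with one constant for all v. For r = 1 the conjugate
  exponent is infinite and \<sigma> is essentially bounded, hence the separate case.\<close>

lemma sigma_estimate:
  "\<exists>C\<ge>0. \<forall>v\<in>W. integrable M (\<lambda>x. \<sigma> x * v x) \<and> (LINT x|M. \<bar>\<sigma> x * v x\<bar>) \<le> C * nrm v"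
proof (cases "r = 1")
  case True
  then have "Inf {C. AE x in M. ennreal (norm (\<sigma> x)) \<le> C} < \<infinity>"
    using sigma by (simp add: Lspace_def conj_exponent_def Lnorm_def)
  then obtain C where C: "AE x in M. ennreal (norm (\<sigma> x)) \<le> C" "C < \<infinity>"
    by (auto simp: Inf_less_iff)
  define c where "c = enn2real C"
  have c: "0 \<le> c" "C = ennreal c"
    using C(2) by (auto simp: c_def less_top)
  have ae: "AE x in M. \<bar>\<sigma> x\<bar> \<le> c"
    using C(1) by eventually_elim (simp add: c)
  have one: "(1::real) \<in> {1..pstar}"
    using exponents by auto
  have v1: "integrable M v" and int: "integrable M (\<lambda>x. \<sigma> x * v x)"
    and le: "AE x in M. \<bar>\<sigma> x * v x\<bar> \<le> c * \<bar>v x\<bar>" if v: "v \<in> W" for v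
  proof -
    show v1: "integrable M v"
      using Sobolev_embedding(1)[OF v one] W_D(2)[OF v] by (simp add: integrable_abs_iff)
    show le: "AE x in M. \<bar>\<sigma> x * v x\<bar> \<le> c * \<bar>v x\<bar>"
      using ae by eventually_elim (simp add: abs_mult mult_right_mono)
    show "integrable M (\<lambda>x. \<sigma> x * v x)"
    proof (rule Bochner_Integration.integrable_bound)
      show "integrable M (\<lambda>x. c * \<bar>v x\<bar>)"
        using v1 by simp
      show "AE x in M. norm (\<sigma> x * v x) \<le> norm (c * \<bar>v x\<bar>)"
        using le by eventually_elim (use c(1) in \<open>simp add: abs_mult\<close>)
    qed (use sigma_measurable W_D(2)[OF v] in measurable)
  qed
  show ?thesis
  proof (rule exI[of _ "c * S 1"], intro conjI ballI)
    show "0 \<le> c * S 1"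
      using c S_pos[OF one] by simp
    fix v assume v: "v \<in> W"
    show "(LINT x|M. \<bar>\<sigma> x * v x\<bar>) \<le> c * S 1 * nrm v"
    proof -
      have "(LINT x|M. \<bar>\<sigma> x * v x\<bar>) \<le> (LINT x|M. c * \<bar>v x\<bar>)"
        using int[OF v] v1[OF v] le[OF v] by (intro integral_mono_AE) auto
      also have "\<dots> = c * lp_norm M 1 v"
        by (simp add: lp_norm_def)
      also have "\<dots> \<le> c * (S 1 * nrm v)"
        using c Sobolev_embedding(2)[OF v one] by (intro mult_left_mono)
      finally show ?thesis by (simp add: mult.assoc)
    qed
  qed (rule int)
next
  case False
  then have r1: "1 < r"
    using r by simp
  \<comment> \<open>P is the conjugate of r, and P/(P-1) is r again, so
    \<open>Holder_powr_mult\<close> with power 1 on \<sigma> leaves the r-norm of v.\<close>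
  define P where "P = r / (r - 1)"
  have P: "1 < P" "P / (P - 1) = r"
    using r1 by (auto simp: P_def field_simps)
  have P0: "0 < P"
    using P by simp
  have L: "\<sigma> \<in> Lspace \<Omega> P"
    using sigma False by (simp add: conj_exponent_def P_def)
  have m: "(\<lambda>x. norm (\<sigma> x)) \<in> borel_measurable M"
    using sigma_measurable by simp
  note D = LspaceD(1)[OF P0 L m]
  show ?thesis
  proof (rule exI[of _ "lp_norm M P \<sigma> * S r"], intro conjI ballI)
    fix v assume v: "v \<in> W"
    have vr: "integrable M (\<lambda>x. norm (v x) powr (P / (P - 1)))"
      unfolding P by (rule Sobolev_embedding(1)[OF v exponent_ranges(8)])
    note H = integrable_powr_mult[OF _ P(1) m D W_D(2)[OF v] vr] Holder_powr_mult[OF _ P(1) m D W_D(2)[OF v] vr]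
    have "integrable M (\<lambda>x. \<bar>\<sigma> x * v x\<bar>)"
      using H(1) by (simp add: abs_mult)
    then show "integrable M (\<lambda>x. \<sigma> x * v x)"
      using sigma_measurable W_D(2)[OF v] by (subst (asm) integrable_abs_iff) auto
    have "(LINT x|M. \<bar>\<sigma> x * v x\<bar>) \<le> lp_norm M P \<sigma> * lp_norm M r v"
      using H(2) by (simp add: abs_mult P)
    also have "\<dots> \<le> lp_norm M P \<sigma> * (S r * nrm v)"
      using Sobolev_embedding(2)[OF v exponent_ranges(8)] by (intro mult_left_mono) auto
    finally show "(LINT x|M. \<bar>\<sigma> x * v x\<bar>) \<le> lp_norm M P \<sigma> * S r * nrm v"
      by (simp add: mult.assoc)
  qed (use S_pos[OF exponent_ranges(8)] in simp)
qed

lemma reaction_measurable: "u \<in> W \<Longrightarrow> reaction u \<in> borel_measurable M"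
  unfolding reaction_def[abs_def]
  by (rule caratheodory_compose_measurable[OF sets_domain f T_D(2,3)])

text \<open>The set E serves two purposes: E = \<Omega> gives the growth bound behind coercivity,
  and shrinking E gives uniform integrability.\<close>

lemma reaction_estimate:
  assumes u: "u \<in> W" and v: "v \<in> W"
  shows "integrable M (\<lambda>x. reaction u x * v x)"
    and "E \<in> sets M \<Longrightarrow> (LINT x|M. indicator E x * \<bar>reaction u x * v x\<bar>)
      \<le> (LINT x|M. indicator E x * \<bar>\<sigma> x * v x\<bar>)
        + a1 * (K1 * nrm u powr (p - 1) + K3) * lp_norm M s1 (\<lambda>x. indicator E x * v x)
        + a2 * (K2 * nrm u powr (p - 1) + K3) * lp_norm M s2 (\<lambda>x. indicator E x * v x)"
proof -
  have sv: "integrable M (\<lambda>x. \<sigma> x * v x)"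
    using sigma_estimate v by blast
  have Tm: "(\<lambda>x. norm (T u x)) \<in> borel_measurable M" and gm: "(\<lambda>x. norm (grad \<Omega> (T u) x)) \<in> borel_measurable M"
    using T_D(2,3)[OF u] by simp_all
  have ev: "(\<lambda>x. indicator E x * v x) \<in> borel_measurable M"
    and e1: "integrable M (\<lambda>x. norm (indicator E x * v x) powr s1)"
    and e2: "integrable M (\<lambda>x. norm (indicator E x * v x) powr s2)" if E: "E \<in> sets M" for E
  proof -
    show "(\<lambda>x. indicator E x * v x) \<in> borel_measurable M"
      using E W_D(2)[OF v] by measurable
    have eq: "norm (indicator E x * v x) powr s = indicator E x *\<^sub>R norm (v x) powr s" for x s
      by (auto simp: indicator_def)
    show "integrable M (\<lambda>x. norm (indicator E x * v x) powr s1)" "integrable M (\<lambda>x. norm (indicator E x * v x) powr s2)"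
      unfolding eq by (intro integrable_mult_indicator[OF E] Sobolev_embedding(1)[OF v] exponent_ranges)+
  qed
  \<comment> \<open>The indicator is attached to v alone, so the factors with T u are bounded by
    their norms over all of \<Omega>, independently of E.\<close>
  let ?B1 = "\<lambda>E x. norm (T u x) powr \<alpha> * \<bar>indicator E x * v x\<bar>"
  let ?B2 = "\<lambda>E x. norm (grad \<Omega> (T u) x) powr \<beta> * \<bar>indicator E x * v x\<bar>"
  let ?R = "\<lambda>E x. indicator E x * \<bar>\<sigma> x * v x\<bar> + a1 * ?B1 E x + a2 * ?B2 E x"
  have B1: "integrable M (?B1 E)" if E: "E \<in> sets M" for E
    by (rule integrable_powr_mult[OF alpha(1) exponent_ranges(4) Tm T_estimate(1)[OF u] ev[OF E] e1[OF E]])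
  have B2: "integrable M (?B2 E)" if E: "E \<in> sets M" for E
    by (rule integrable_powr_mult[OF beta(1) exponent_ranges(5) gm T_D(5)[OF u] ev[OF E] e2[OF E]])
  have sE: "integrable M (\<lambda>x. indicator E x * \<bar>\<sigma> x * v x\<bar>)" if E: "E \<in> sets M" for E
    using integrable_mult_indicator[OF E integrable_abs[OF sv]] by simp
  have R: "integrable M (?R E)" if E: "E \<in> sets M" for E
    using sE[OF E] B1[OF E] B2[OF E] by (intro Bochner_Integration.integrable_add integrable_mult_right)
  have le: "AE x in M. indicator E x * \<bar>reaction u x * v x\<bar> \<le> ?R E x" for E
    using growth
  proof eventually_elim
    case (elim x)
    then have "\<bar>reaction u x\<bar> \<le> \<bar>\<sigma> x\<bar> + a1 * norm (T u x) powr \<alpha> + a2 * norm (grad \<Omega> (T u) x) powr \<beta>"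
      using abs_ge_self[of "\<sigma> x"] unfolding reaction_def real_norm_def by (smt (verit))
    from mult_right_mono[OF this, of "\<bar>v x\<bar>"]
    show ?case
      by (auto simp: abs_mult indicator_def algebra_simps)
  qed
  have "integrable M (\<lambda>x. reaction u x * v x)"
  proof (rule Bochner_Integration.integrable_bound)
    show "integrable M (?R \<Omega>)"
      by (rule R) (rule sets_lebesgue_on_refl)
    show "(\<lambda>x. reaction u x * v x) \<in> borel_measurable M"
      using reaction_measurable[OF u] W_D(2)[OF v] by measurable
    show "AE x in M. norm (reaction u x * v x) \<le> norm (?R \<Omega> x)"
      using le[of \<Omega>] AE_space
    proof eventually_elim
      case (elim x)
      then have "norm (reaction u x * v x) \<le> ?R \<Omega> x"
        by (simp add: space_restrict_space)
      also have "\<dots> \<le> norm (?R \<Omega> x)"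
        unfolding real_norm_def by (rule abs_ge_self)
      finally show ?case .
    qed
  qed
  then show int: "integrable M (\<lambda>x. reaction u x * v x)" .
  assume E: "E \<in> sets M"
  have "(LINT x|M. indicator E x * \<bar>reaction u x * v x\<bar>) \<le> (LINT x|M. ?R E x)"
    using integrable_mult_indicator[OF E integrable_abs[OF int]] R[OF E] le[of E]
    by (intro integral_mono_AE) auto
  also have "\<dots> = (LINT x|M. indicator E x * \<bar>\<sigma> x * v x\<bar>) + a1 * (LINT x|M. ?B1 E x) + a2 * (LINT x|M. ?B2 E x)"
    using sE[OF E] B1[OF E] B2[OF E] by simp
  also have "\<dots> \<le> (LINT x|M. indicator E x * \<bar>\<sigma> x * v x\<bar>)
        + a1 * ((K1 * nrm u powr (p - 1) + K3) * lp_norm M s1 (\<lambda>x. indicator E x * v x))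
        + a2 * ((K2 * nrm u powr (p - 1) + K3) * lp_norm M s2 (\<lambda>x. indicator E x * v x))"
  proof (intro add_mono mult_left_mono a order_refl)
    have "(LINT x|M. ?B1 E x) \<le> lp_norm M pstar (T u) powr \<alpha> * lp_norm M s1 (\<lambda>x. indicator E x * v x)"
      by (rule Holder_powr_mult[OF alpha(1) exponent_ranges(4) Tm T_estimate(1)[OF u] ev[OF E] e1[OF E]])
    also have "\<dots> \<le> (K1 * nrm u powr (p - 1) + K3) * lp_norm M s1 (\<lambda>x. indicator E x * v x)"
      by (intro mult_right_mono T_estimate(2)[OF u]) simp
    finally show "(LINT x|M. ?B1 E x) \<le> (K1 * nrm u powr (p - 1) + K3) * lp_norm M s1 (\<lambda>x. indicator E x * v x)" .
    have "(LINT x|M. ?B2 E x) \<le> nrm (T u) powr \<beta> * lp_norm M s2 (\<lambda>x. indicator E x * v x)"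
      by (rule Holder_powr_mult[OF beta(1) exponent_ranges(5) gm T_D(5)[OF u] ev[OF E] e2[OF E]])
    also have "\<dots> \<le> (K2 * nrm u powr (p - 1) + K3) * lp_norm M s2 (\<lambda>x. indicator E x * v x)"
      by (intro mult_right_mono T_estimate(3)[OF u]) simp
    finally show "(LINT x|M. ?B2 E x) \<le> (K2 * nrm u powr (p - 1) + K3) * lp_norm M s2 (\<lambda>x. indicator E x * v x)" .
  qed
  finally show "(LINT x|M. indicator E x * \<bar>reaction u x * v x\<bar>)
      \<le> (LINT x|M. indicator E x * \<bar>\<sigma> x * v x\<bar>)
        + a1 * (K1 * nrm u powr (p - 1) + K3) * lp_norm M s1 (\<lambda>x. indicator E x * v x)
        + a2 * (K2 * nrm u powr (p - 1) + K3) * lp_norm M s2 (\<lambda>x. indicator E x * v x)"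
    by (simp add: mult.assoc)
qed

definition \<kappa> :: real where
  "\<kappa> = a1 * K1 * S s1 + a2 * K2 * S s2"

text \<open>Only the terms with K1 and K2 carry the power p - 1 of the norm of u, and the embedding
  constants turn their coefficients into \<kappa>. \<sigma> and K3 go into C, which multiplies the
  norm of v alone.\<close>

lemma reaction_growth:
  "\<exists>C\<ge>0. \<forall>u\<in>W. \<forall>v\<in>W.
    \<bar>LINT x|M. reaction u x * v x\<bar> \<le> \<kappa> * nrm u powr (p - 1) * nrm v + C * nrm v"
proof -
  obtain C where C: "0 \<le> C" "\<And>v. v \<in> W \<Longrightarrow> (LINT x|M. \<bar>\<sigma> x * v x\<bar>) \<le> C * nrm v"
    using sigma_estimate by blast
  note S1 = S_pos[OF exponent_ranges(6)] and S2 = S_pos[OF exponent_ranges(7)]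
  have "\<bar>LINT x|M. reaction u x * v x\<bar> \<le> \<kappa> * nrm u powr (p - 1) * nrm v
      + (C + a1 * K3 * S s1 + a2 * K3 * S s2) * nrm v" if u: "u \<in> W" and v: "v \<in> W" for u v
  proof -
    have on: "(LINT x|M. indicator \<Omega> x * g x) = (LINT x|M. g x)" for g :: "'a \<Rightarrow> real"
      by (intro Bochner_Integration.integral_cong) (auto simp: space_restrict_space)
    have onL: "lp_norm M s (\<lambda>x. indicator \<Omega> x * v x) = lp_norm M s v" for s
      unfolding lp_norm_def
      by (intro arg_cong[where f = "\<lambda>y. y powr (1 / s)"] Bochner_Integration.integral_cong)
        (auto simp: space_restrict_space)
    have "\<bar>LINT x|M. reaction u x * v x\<bar> \<le> (LINT x|M. \<bar>reaction u x * v x\<bar>)"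
      by (rule integral_abs_bound)
    also have "\<dots> \<le> (LINT x|M. \<bar>\<sigma> x * v x\<bar>) + a1 * (K1 * nrm u powr (p - 1) + K3) * lp_norm M s1 v
        + a2 * (K2 * nrm u powr (p - 1) + K3) * lp_norm M s2 v"
      using reaction_estimate(2)[OF u v sets_lebesgue_on_refl] by (simp only: on onL)
    also have "\<dots> \<le> C * nrm v + a1 * (K1 * nrm u powr (p - 1) + K3) * (S s1 * nrm v)
        + a2 * (K2 * nrm u powr (p - 1) + K3) * (S s2 * nrm v)"
      using a K by (intro add_mono C(2) v mult_left_mono Sobolev_embedding(2) exponent_ranges) auto
    also have "\<dots> = \<kappa> * nrm u powr (p - 1) * nrm v + (C + a1 * K3 * S s1 + a2 * K3 * S s2) * nrm v"
      by (simp add: \<kappa>_def algebra_simps)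
    finally show ?thesis .
  qed
  moreover have "0 \<le> C + a1 * K3 * S s1 + a2 * K3 * S s2"
    using C(1) a K S1 S2 by (intro add_nonneg_nonneg mult_nonneg_nonneg) auto
  ultimately show ?thesis
    by blast
qed

text \<open>Along a subsequence the integrands converge almost everywhere by continuity of f in its
  last two arguments. Since v does not vary with k, its norms over the shrinking sets tend to 0 once
  and for all.\<close>

lemma reaction_continuous:
  assumes u: "\<And>k. u k \<in> W" and w: "w \<in> W" and v: "v \<in> W"
    and lim: "(\<lambda>k. nrm (\<lambda>x. u k x - w x)) \<longlonglongrightarrow> 0" and R: "\<And>k. nrm (u k) \<le> R"
  shows "(\<lambda>k. LINT x|M. reaction (u k) x * v x) \<longlonglongrightarrow> (LINT x|M. reaction w x * v x)"
proof (rule tendsto_subseqI)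
  fix g :: "nat \<Rightarrow> nat" assume g: "strict_mono g"
  have lim_g: "(\<lambda>k. nrm (\<lambda>x. u (g k) x - w x)) \<longlonglongrightarrow> 0"
    using LIMSEQ_subseq_LIMSEQ[OF lim g] by (simp add: o_def)
  obtain h :: "nat \<Rightarrow> nat" where h: "strict_mono h"
    and limT: "AE x in M. (\<lambda>k. T (u (g (h k))) x) \<longlonglongrightarrow> T w x"
      "AE x in M. (\<lambda>k. grad \<Omega> (T (u (g (h k)))) x) \<longlonglongrightarrow> grad \<Omega> (T w) x"
    by (rule continuous_sobolev_map_subseq[OF open_domain exponent_ranges(1) T _ w lim_g]) (rule u)
  let ?y = "\<lambda>k. u (g (h k))"
  have y: "?y k \<in> W" for k
    by (rule u)
  have "(\<lambda>k. LINT x|M. reaction (?y k) x * v x) \<longlonglongrightarrow> (LINT x|M. reaction w x * v x)"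
  proof (rule Vitali_convergence[OF finite_measure_M])
    show "integrable M (\<lambda>x. reaction (?y k) x * v x)" for k
      by (rule reaction_estimate(1)[OF y v])
    show "integrable M (\<lambda>x. reaction w x * v x)"
      by (rule reaction_estimate(1)[OF w v])
    have "AE x in M. continuous_on UNIV (\<lambda>(s, \<xi>). f x s \<xi>)"
      using f by (simp add: caratheodory_def)
    with limT show "AE x in M. (\<lambda>k. reaction (?y k) x * v x) \<longlonglongrightarrow> reaction w x * v x"
    proof eventually_elim
      case (elim x)
      then have "isCont (\<lambda>(s, \<xi>). f x s \<xi>) (T w x, grad \<Omega> (T w) x)"
        by (simp add: continuous_on_eq_continuous_at)
      from isCont_tendsto_compose[OF this tendsto_Pair[OF elim(1,2)]] show ?case
        unfolding reaction_def by (intro tendsto_mult_right) simp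
    qed
    fix E :: "nat \<Rightarrow> 'a set" and \<epsilon> :: real
    assume E: "\<And>m. E m \<in> sets M" "decseq E" "AE x in M. x \<notin> (\<Inter>m. E m)" and \<epsilon>: "0 < \<epsilon>"
    \<comment> \<open>The bound of \<open>reaction_estimate\<close> with R in place of the norm of
      u; this removes the dependence on k.\<close>
    let ?B = "\<lambda>m. (LINT x|M. indicator (E m) x * \<bar>\<sigma> x * v x\<bar>)
        + a1 * (K1 * R powr (p - 1) + K3) * lp_norm M s1 (\<lambda>x. indicator (E m) x * v x)
        + a2 * (K2 * R powr (p - 1) + K3) * lp_norm M s2 (\<lambda>x. indicator (E m) x * v x)"
    have "integrable M (\<lambda>x. \<sigma> x * v x)"
      using sigma_estimate v by blast
    then have "(\<lambda>m. lp_norm M 1 (\<lambda>x. indicator (E m) x * (\<sigma> x * v x))) \<longlonglongrightarrow> 0"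
      by (intro lp_norm_shrinking_tendsto_0 E) auto
    then have "(\<lambda>m. LINT x|M. indicator (E m) x * \<bar>\<sigma> x * v x\<bar>) \<longlonglongrightarrow> 0"
      by (simp add: lp_norm_def abs_mult)
    moreover have "(\<lambda>m. lp_norm M s (\<lambda>x. indicator (E m) x * v x)) \<longlonglongrightarrow> 0" if "s \<in> {1..pstar}" for s
      using that by (intro lp_norm_shrinking_tendsto_0 E W_D(2)[OF v] Sobolev_embedding(1)[OF v]) auto
    ultimately have "?B \<longlonglongrightarrow> 0 + a1 * (K1 * R powr (p - 1) + K3) * 0 + a2 * (K2 * R powr (p - 1) + K3) * 0"
      using exponent_ranges(6,7) by (intro tendsto_intros) auto
    then have "\<forall>\<^sub>F m in sequentially. ?B m < \<epsilon>"
      using \<epsilon> by (intro order_tendstoD) simp_all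
    then obtain m where m: "?B m < \<epsilon>"
      by (auto simp: eventually_sequentially)
    have "(LINT x|M. indicator (E m) x * \<bar>reaction (?y k) x * v x\<bar>) \<le> \<epsilon>" for k
    proof -
      have y_bound: "nrm (?y k) powr (p - 1) \<le> R powr (p - 1)"
        using R exponent_ranges(2) by (intro powr_mono2) auto
      have "(LINT x|M. indicator (E m) x * \<bar>reaction (?y k) x * v x\<bar>)
        \<le> (LINT x|M. indicator (E m) x * \<bar>\<sigma> x * v x\<bar>)
        + a1 * (K1 * nrm (?y k) powr (p - 1) + K3) * lp_norm M s1 (\<lambda>x. indicator (E m) x * v x)
        + a2 * (K2 * nrm (?y k) powr (p - 1) + K3) * lp_norm M s2 (\<lambda>x. indicator (E m) x * v x)"
        by (rule reaction_estimate(2)[OF y v E(1)])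
      also have "(LINT x|M. indicator (E m) x * \<bar>\<sigma> x * v x\<bar>)
        + a1 * (K1 * nrm (?y k) powr (p - 1) + K3) * lp_norm M s1 (\<lambda>x. indicator (E m) x * v x)
        + a2 * (K2 * nrm (?y k) powr (p - 1) + K3) * lp_norm M s2 (\<lambda>x. indicator (E m) x * v x) \<le> ?B m"
        using a K y_bound by (intro add_mono mult_right_mono mult_left_mono) auto
      also have "\<dots> < \<epsilon>"
        by (rule m)
      finally show ?thesis
        by simp
    qed
    then show "\<exists>m. \<forall>k. (LINT x|M. indicator (E m) x * \<bar>reaction (?y k) x * v x\<bar>) \<le> \<epsilon>"
      by blast
  qed
  with h show "\<exists>s. strict_mono s \<and> (\<lambda>k. LINT x|M. reaction (u (g (s k))) x * v x) \<longlonglongrightarrow> (LINT x|M. reaction w x * v x)"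
    by blast
qed

end

section \<open>The Galerkin system\<close>

lemma integrable_norm_powr_sum:
  fixes u :: "'i \<Rightarrow> 'a \<Rightarrow> 'b::{real_normed_vector, second_countable_topology}"
  assumes p: "0 < p" and "finite I"
    and "\<And>i. i \<in> I \<Longrightarrow> u i \<in> borel_measurable M" "\<And>i. i \<in> I \<Longrightarrow> integrable M (\<lambda>x. norm (u i x) powr p)"
  shows "integrable M (\<lambda>x. norm (\<Sum>i\<in>I. u i x) powr p)"
  using assms(2-)
proof (induction rule: finite_induct)
  case empty
  then show ?case by simp
next
  case (insert i I)
  have "integrable M (\<lambda>x. norm (1 *\<^sub>R u i x + 1 *\<^sub>R (\<Sum>i\<in>I. u i x)) powr p)"
    using insert p by (intro integrable_norm_powr_lincomb borel_measurable_sum) auto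
  with insert show ?case by simp
qed

lemma lp_norm_cong_AE:
  assumes "u \<in> borel_measurable M" "v \<in> borel_measurable M" "AE x in M. u x = v x"
  shows "lp_norm M r u = lp_norm M r v"
proof -
  have "AE x in M. norm (u x) powr r = norm (v x) powr r"
    using assms(3) by eventually_elim simp
  then have "(LINT x|M. norm (u x) powr r) = (LINT x|M. norm (v x) powr r)"
    using assms by (intro integral_cong_AE) auto
  then show ?thesis
    by (simp add: lp_norm_def)
qed

text \<open>For s < 2 the first factor is singular at y = 0. By the convention
  \<open>0 powr a = 0\<close> both sides vanish there, so the inequality holds at every y and for
  every s.\<close>

lemma norm_powr_inner_le:
  fixes y z :: "'a::real_inner"
  shows "\<bar>norm y powr (s - 2) * (y \<bullet> z)\<bar> \<le> norm y powr (s - 1) * norm z"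
proof -
  have "\<bar>norm y powr (s - 2) * (y \<bullet> z)\<bar> \<le> norm y powr (s - 2) * (norm y * norm z)"
    by (simp add: abs_mult mult_left_mono Cauchy_Schwarz_ineq2)
  also have "\<dots> = norm y powr (s - 1) * norm z"
    using powr_mult_base[of "norm y" "s - 2"] by (simp add: mult.assoc mult.commute)
  finally show ?thesis .
qed

text \<open>Comparing with a number m that is at least 1 allows the exponent s to be raised to p, so
  one integrable bound serves both the p-flux and the q-flux.\<close>

lemma norm_powr_inner_bound:
  fixes y z :: "'a::real_inner"
  assumes s: "1 < s" "s \<le> p"
  shows "\<bar>norm y powr (s - 2) * (y \<bullet> z)\<bar> \<le> 1 + norm y powr p + norm z powr p"
proof -
  define m where "m = max 1 (max (norm y) (norm z))"
  have m: "1 \<le> m" "norm y \<le> m" "norm z \<le> m"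
    by (auto simp: m_def)
  have "\<bar>norm y powr (s - 2) * (y \<bullet> z)\<bar> \<le> norm y powr (s - 1) * norm z"
    by (rule norm_powr_inner_le)
  also have "\<dots> \<le> m powr (s - 1) * m"
    using s m by (intro mult_mono powr_mono2) auto
  also have "\<dots> = m powr s"
    using m powr_mult_base[of m "s - 1"] by (simp add: mult.commute)
  also have "\<dots> \<le> m powr p"
    using s m by (intro powr_mono) auto
  also have "\<dots> \<le> 1 + norm y powr p + norm z powr p"
    by (auto simp: m_def max_def)
  finally show ?thesis .
qed

lemma norm_powr_inner_self:
  fixes y :: "'a::real_inner"
  shows "norm y powr (s - 2) * (y \<bullet> y) = norm y powr s"
proof -
  have "norm y powr (s - 2) * (y \<bullet> y) = norm y * (norm y * norm y powr (s - 2))"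
    by (simp add: dot_square_norm power2_eq_square mult_ac)
  also have "\<dots> = norm y powr s"
    using powr_mult_base[of "norm y" "s - 2"] powr_mult_base[of "norm y" "s - 1"] by simp
  finally show ?thesis .
qed

text \<open>Only y0 = 0 is delicate, as s - 2 may be negative. There Cauchy-Schwarz leaves the power
  s - 1, which is positive and forces the limit 0.\<close>

lemma tendsto_norm_powr_inner:
  fixes y :: "nat \<Rightarrow> 'a::real_inner"
  assumes s: "1 < s" and y: "y \<longlonglongrightarrow> y0"
  shows "(\<lambda>k. norm (y k) powr (s - 2) * (y k \<bullet> z)) \<longlonglongrightarrow> norm y0 powr (s - 2) * (y0 \<bullet> z)"
proof (cases "y0 = 0")
  case False
  then show ?thesis
    by (intro tendsto_intros y) auto
next
  case True
  then have "(\<lambda>k. norm (y k)) \<longlonglongrightarrow> 0"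
    using y tendsto_norm_zero by blast
  then have "(\<lambda>k. norm (y k) powr (s - 1)) \<longlonglongrightarrow> 0"
    using s by (intro tendsto_zero_powrI[where b = "s - 1"]) auto
  then have "(\<lambda>k. norm (y k) powr (s - 1) * norm z) \<longlonglongrightarrow> 0"
    by (rule tendsto_mult_left_zero)
  then have "(\<lambda>k. norm (y k) powr (s - 2) * (y k \<bullet> z)) \<longlonglongrightarrow> 0"
    by (rule Lim_null_comparison[rotated]) (simp add: norm_powr_inner_le)
  with True show ?thesis
    by simp
qed

section \<open>Energies of the two Laplacians and coercivity\<close>

context convective_problem
begin

text \<open>\<open>laplacian_pairing\<close> is minus the integral of this function, so the operator
  of the equation is the p-flux minus the q-flux.\<close>

definition flux :: "real \<Rightarrow> ('a \<Rightarrow> real) \<Rightarrow> ('a \<Rightarrow> real) \<Rightarrow> 'a \<Rightarrow> real" where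
  "flux s u v x = norm (grad \<Omega> u x) powr (s - 2) * (grad \<Omega> u x \<bullet> grad \<Omega> v x)"

lemma flux_measurable: "u \<in> W \<Longrightarrow> v \<in> W \<Longrightarrow> flux s u v \<in> borel_measurable M"
  unfolding flux_def[abs_def] using W_D(3)[of u] W_D(3)[of v] by measurable

lemma flux_integrable:
  assumes u: "u \<in> W" and v: "v \<in> W" and s: "1 < s" "s \<le> p"
  shows "integrable M (flux s u v)"
proof (rule Bochner_Integration.integrable_bound)
  interpret finite_measure M by (rule finite_measure_M)
  show "integrable M (\<lambda>x. 1 + norm (grad \<Omega> u x) powr p + norm (grad \<Omega> v x) powr p)"
    by (intro Bochner_Integration.integrable_add W_D u v) simp
  show "AE x in M. norm (flux s u v x) \<le> norm (1 + norm (grad \<Omega> u x) powr p + norm (grad \<Omega> v x) powr p)"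
    using norm_powr_inner_bound[OF s] by (auto simp: flux_def)
qed (rule flux_measurable[OF u v])

lemma integral_flux_p: "(LINT x|M. flux p u u x) = nrm u powr p"
  using exponent_ranges(1) by (simp add: flux_def norm_powr_inner_self lp_norm_powr)

text \<open>
  The \<open>q\<close>-energy is absorbed through \<open>y powr q \<le> \<epsilon> * y powr p + L powr q\<close>, where
  \<open>L powr (q - p) = \<epsilon>\<close>.
\<close>

lemma coercive:
  "\<exists>t0>0. \<forall>u\<in>W. t0 \<le> nrm u \<longrightarrow>
    0 < (LINT x|M. flux p u u x) - (LINT x|M. flux q u u x) - (LINT x|M. reaction u x * u x)"
proof -
  interpret finite_measure M by (rule finite_measure_M)
  \<comment> \<open>The gap 1 - \<kappa> is split evenly: one half absorbs the q-energy up to the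
    constant D, the other absorbs D and the linear term with C.\<close>
  define \<epsilon> where "\<epsilon> = (1 - \<kappa>) / 2"
  have \<epsilon>: "0 < \<epsilon>" "1 - \<kappa> = 2 * \<epsilon>"
    using small by (auto simp: \<epsilon>_def \<kappa>_def)
  define L where "L = \<epsilon> powr (1 / (q - p))"
  have L: "0 < L" "L powr (q - p) = \<epsilon>"
    using \<epsilon> exponents by (auto simp: L_def powr_powr)
  define D where "D = L powr q * measure M (space M)"
  have D: "0 \<le> D"
    by (simp add: D_def)
  obtain C where C: "0 \<le> C" "\<And>u v. u \<in> W \<Longrightarrow> v \<in> W \<Longrightarrow>
    \<bar>LINT x|M. reaction u x * v x\<bar> \<le> \<kappa> * nrm u powr (p - 1) * nrm v + C * nrm v"
    using reaction_growth by blast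
  \<comment> \<open>For t \<ge> t0 the second entry makes \<open>\<epsilon> * t powr (p - 1)\<close>
    at least C + D + 1; the first gives t \<ge> 1, so that D is at most D t.\<close>
  define t0 where "t0 = max 1 (((C + D + 1) / \<epsilon>) powr (1 / (p - 1)))"
  have young: "y powr q \<le> \<epsilon> * y powr p + L powr q" if "0 \<le> y" for y
  proof (cases "L \<le> y")
    case True
    then have "y powr q = y powr (q - p) * y powr p"
      using L by (simp flip: powr_add)
    also have "\<dots> \<le> L powr (q - p) * y powr p"
      using True L exponents by (intro mult_right_mono powr_mono2') auto
    also have "\<dots> = \<epsilon> * y powr p"
      by (simp only: L(2))
    finally show ?thesis
      using powr_ge_zero[of L q] by linarith
  next
    case False
    then have "y powr q \<le> L powr q"
      using that exponents by (intro powr_mono2) auto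
    then show ?thesis
      using \<epsilon> by (smt (verit) mult_nonneg_nonneg powr_ge_zero)
  qed
  have "0 < (LINT x|M. flux p u u x) - (LINT x|M. flux q u u x) - (LINT x|M. reaction u x * u x)"
    if u: "u \<in> W" and t: "t0 \<le> nrm u" for u
  proof -
    let ?t = "nrm u"
    have t1: "1 \<le> ?t" "((C + D + 1) / \<epsilon>) powr (1 / (p - 1)) \<le> ?t"
      using t by (auto simp: t0_def)
    have "(LINT x|M. flux q u u x) \<le> (LINT x|M. \<epsilon> * norm (grad \<Omega> u x) powr p + L powr q)"
    proof (rule integral_mono)
      show "integrable M (flux q u u)"
        using exponents by (intro flux_integrable u) auto
      show "integrable M (\<lambda>x. \<epsilon> * norm (grad \<Omega> u x) powr p + L powr q)"
        using W_D(5)[OF u] by simp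
      show "flux q u u x \<le> \<epsilon> * norm (grad \<Omega> u x) powr p + L powr q" for x
        unfolding flux_def norm_powr_inner_self by (rule young) simp
    qed
    also have "\<dots> = \<epsilon> * ?t powr p + D"
      using W_D(5)[OF u] exponent_ranges(1) by (simp add: lp_norm_powr D_def)
    finally have Q: "(LINT x|M. flux q u u x) \<le> \<epsilon> * ?t powr p + D" .
    have tp: "?t powr (p - 1) * ?t = ?t powr p"
      using powr_mult_base[of ?t "p - 1"] by (simp add: mult.commute)
    have F: "(LINT x|M. reaction u x * u x) \<le> \<kappa> * ?t powr p + C * ?t"
      using C(2)[OF u u] unfolding mult.assoc tp by linarith
    have "(C + D + 1) / \<epsilon> = (((C + D + 1) / \<epsilon>) powr (1 / (p - 1))) powr (p - 1)"
      using exponent_ranges(2) C D \<epsilon> by (simp add: powr_powr)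
    also have "\<dots> \<le> ?t powr (p - 1)"
      using t1 exponent_ranges(2) by (intro powr_mono2) auto
    finally have "C + D + 1 \<le> \<epsilon> * ?t powr (p - 1)"
      using \<epsilon> by (simp add: divide_le_eq mult.commute)
    then have "(C + D + 1) * ?t \<le> \<epsilon> * ?t powr (p - 1) * ?t"
      using t1 by (intro mult_right_mono) auto
    also have "\<dots> = \<epsilon> * ?t powr p"
      by (simp add: mult.assoc tp)
    finally have "C * ?t + D * ?t + ?t \<le> \<epsilon> * ?t powr p"
      by (simp add: algebra_simps)
    moreover have "D \<le> D * ?t"
      using D t1 by (simp add: mult_le_cancel_left1)
    ultimately have lower: "C * ?t + D + 1 \<le> \<epsilon> * ?t powr p"
      using t1 by linarith
    have "?t powr p = \<kappa> * ?t powr p + 2 * (\<epsilon> * ?t powr p)"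
      using \<epsilon>(2) by (simp add: algebra_simps) (metis distrib_right mult.commute mult_2 mult_1 add_diff_cancel_left' diff_add_cancel)
    then show ?thesis
      using Q F lower unfolding integral_flux_p by linarith
  qed
  moreover have "0 < t0"
    by (simp add: t0_def)
  ultimately show ?thesis
    by blast
qed

end

text \<open>Independence is expressed by the gradient norm, because it is used to bound this norm
  from below on the boundary of a cube of coefficients. \<open>comb_W\<close> will come from the
  Galerkin space being a subspace.\<close>

locale convective_galerkin = convective_problem +
  fixes b :: "nat \<Rightarrow> 'a \<Rightarrow> real" and n :: nat
  assumes comb_W: "\<And>c. (\<lambda>x. \<Sum>i<n. c i * b i x) \<in> W"
    and b_W: "\<And>i. i < n \<Longrightarrow> b i \<in> W"
    and independent: "\<And>c i. i < n \<Longrightarrow> c i \<noteq> 0 \<Longrightarrow> nrm (\<lambda>x. \<Sum>i<n. c i * b i x) \<noteq> 0"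
begin

definition comb :: "(nat \<Rightarrow> real) \<Rightarrow> 'a \<Rightarrow> real" where
  "comb c x = (\<Sum>i<n. c i * b i x)"

text \<open>A representative of the gradient of \<open>comb c\<close> that is linear in c at every
  point; \<open>grad \<Omega> (comb c)\<close> is a fresh choice for each c and comes with no
  pointwise relation between different c.\<close>

definition gcomb :: "(nat \<Rightarrow> real) \<Rightarrow> 'a \<Rightarrow> 'a" where
  "gcomb c x = (\<Sum>i<n. c i *\<^sub>R grad \<Omega> (b i) x)"

text \<open>Up to the size of the coefficients this dominates all \<open>gcomb c\<close> at once;
  its p-th power is the majorant in the passages to the limit.\<close>

definition envelope :: "'a \<Rightarrow> real" where
  "envelope x = (\<Sum>i<n. norm (grad \<Omega> (b i) x))"

lemma comb_in_W: "comb c \<in> W"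
  using comb_W[of c] by (simp add: comb_def[abs_def])

lemma nrm_comb_pos: "i < n \<Longrightarrow> c i \<noteq> 0 \<Longrightarrow> 0 < nrm (comb c)"
  using independent[of i c] by (simp add: comb_def[abs_def] less_le)

lemma grad_comb: "AE x in M. grad \<Omega> (comb c) x = gcomb c x"
  unfolding comb_def[abs_def] gcomb_def
  by (intro grad_eq_AE open_domain weak_gradient_sum W_D(1) b_W)

lemma gcomb_measurable: "gcomb c \<in> borel_measurable M"
  unfolding gcomb_def[abs_def] by (intro borel_measurable_sum borel_measurable_scaleR W_D(3) b_W) auto

lemma envelope_integrable: "integrable M (\<lambda>x. envelope x powr p)"
proof -
  have "integrable M (\<lambda>x. norm (\<Sum>i<n. norm (grad \<Omega> (b i) x)) powr p)"
    using W_D(3,5)[OF b_W] by (intro integrable_norm_powr_sum exponent_ranges) auto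
  moreover have "norm (\<Sum>i<n. norm (grad \<Omega> (b i) x)) = envelope x" for x
    by (simp add: envelope_def sum_nonneg)
  ultimately show ?thesis
    by simp
qed

lemma norm_gcomb_le:
  assumes "\<And>i. i < n \<Longrightarrow> \<bar>c i\<bar> \<le> R"
  shows "norm (gcomb c x) \<le> R * envelope x"
proof -
  have "norm (gcomb c x) \<le> (\<Sum>i<n. norm (c i *\<^sub>R grad \<Omega> (b i) x))"
    unfolding gcomb_def by (rule norm_sum)
  also have "\<dots> \<le> (\<Sum>i<n. R * norm (grad \<Omega> (b i) x))"
    using assms by (intro sum_mono) (auto intro: mult_right_mono)
  finally show ?thesis
    by (simp add: envelope_def sum_distrib_left)
qed

lemma norm_gcomb_powr_le:
  assumes "\<And>i. i < n \<Longrightarrow> \<bar>c i\<bar> \<le> R" "0 \<le> R"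
  shows "norm (gcomb c x) powr p \<le> R powr p * envelope x powr p"
proof -
  have "norm (gcomb c x) powr p \<le> (R * envelope x) powr p"
    using norm_gcomb_le[OF assms(1)] exponent_ranges(1) by (intro powr_mono2) auto
  also have "\<dots> = R powr p * envelope x powr p"
    by (rule powr_mult)
  finally show ?thesis .
qed

lemma gcomb_tendsto:
  assumes "\<And>i. i < n \<Longrightarrow> (\<lambda>k. c k i) \<longlonglongrightarrow> d i"
  shows "(\<lambda>k. gcomb (c k) x) \<longlonglongrightarrow> gcomb d x"
  unfolding gcomb_def using assms by (intro tendsto_intros) auto

lemma nrm_comb: "nrm (comb c) = lp_norm M p (gcomb c)"
  by (rule lp_norm_cong_AE[OF W_D(3)[OF comb_in_W] gcomb_measurable grad_comb])

lemma nrm_comb_tendsto: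
  assumes c: "\<And>i. i < n \<Longrightarrow> (\<lambda>k. c k i) \<longlonglongrightarrow> d i" and R: "\<And>k i. i < n \<Longrightarrow> \<bar>c k i\<bar> \<le> R" "0 \<le> R"
  shows "(\<lambda>k. nrm (comb (c k))) \<longlonglongrightarrow> nrm (comb d)"
proof -
  have "(\<lambda>k. LINT x|M. norm (gcomb (c k) x) powr p) \<longlonglongrightarrow> (LINT x|M. norm (gcomb d x) powr p)"
  proof (rule integral_dominated_convergence)
    show "integrable M (\<lambda>x. R powr p * envelope x powr p)"
      by (intro integrable_mult_right envelope_integrable)
    show "AE x in M. (\<lambda>k. norm (gcomb (c k) x) powr p) \<longlonglongrightarrow> norm (gcomb d x) powr p"
      using exponent_ranges(1)
      by (intro AE_I2 tendsto_powr2 tendsto_norm gcomb_tendsto c tendsto_const) auto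
    show "AE x in M. norm (norm (gcomb (c k) x) powr p) \<le> R powr p * envelope x powr p" for k
      using norm_gcomb_powr_le[OF R] by simp
  qed (use gcomb_measurable in measurable)
  then show ?thesis
    unfolding nrm_comb unfolding lp_norm_def using exponent_ranges(1)
    by (intro tendsto_powr2 tendsto_const) auto
qed

lemma nrm_comb_diff_tendsto:
  assumes c: "\<And>i. i < n \<Longrightarrow> (\<lambda>k. c k i) \<longlonglongrightarrow> d i" and R: "\<And>k i. i < n \<Longrightarrow> \<bar>c k i\<bar> \<le> R" "0 \<le> R"
    and d: "\<And>i. i < n \<Longrightarrow> \<bar>d i\<bar> \<le> R"
  shows "(\<lambda>k. nrm (\<lambda>x. comb (c k) x - comb d x)) \<longlonglongrightarrow> 0"
proof -
  have "(\<lambda>x. comb (c k) x - comb d x) = comb (\<lambda>i. c k i - d i)" for k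
    by (simp add: comb_def fun_eq_iff left_diff_distrib sum_subtractf)
  moreover have "(\<lambda>k. nrm (comb (\<lambda>i. c k i - d i))) \<longlonglongrightarrow> nrm (comb (\<lambda>i. 0))"
  proof (rule nrm_comb_tendsto[where R = "2 * R"])
    show "(\<lambda>k. c k i - d i) \<longlonglongrightarrow> 0" if "i < n" for i
      using c[OF that] by (simp add: LIM_zero)
    show "\<bar>c k i - d i\<bar> \<le> 2 * R" if "i < n" for k i
      using R(1)[OF that, of k] d[OF that] by linarith
  qed (use R in simp)
  moreover have "nrm (comb (\<lambda>i. 0)) = 0"
    unfolding nrm_comb by (simp add: lp_norm_def gcomb_def)
  ultimately show ?thesis
    by simp
qed

lemma flux_tendsto:
  assumes c: "\<And>i. i < n \<Longrightarrow> (\<lambda>k. c k i) \<longlonglongrightarrow> d i" and R: "\<And>k i. i < n \<Longrightarrow> \<bar>c k i\<bar> \<le> R" "0 \<le> R"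
    and v: "v \<in> W" and s: "1 < s" "s \<le> p"
  shows "(\<lambda>k. LINT x|M. flux s (comb (c k)) v x) \<longlonglongrightarrow> (LINT x|M. flux s (comb d) v x)"
proof (rule integral_dominated_convergence)
  interpret finite_measure M by (rule finite_measure_M)
  \<comment> \<open>The sequence has countably many coefficient vectors, so one null set suffices to
    replace all chosen gradients by \<open>gcomb\<close>.\<close>
  have all: "AE x in M. \<forall>k. grad \<Omega> (comb (c k)) x = gcomb (c k) x"
    using grad_comb by (simp add: AE_all_countable)
  show "integrable M (\<lambda>x. 1 + R powr p * envelope x powr p + norm (grad \<Omega> v x) powr p)"
    by (intro Bochner_Integration.integrable_add integrable_mult_right envelope_integrable W_D(5) v) simp
  show "AE x in M. (\<lambda>k. flux s (comb (c k)) v x) \<longlonglongrightarrow> flux s (comb d) v x"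
    using all grad_comb[of d]
    by eventually_elim (simp add: flux_def tendsto_norm_powr_inner[OF s(1) gcomb_tendsto[OF c]])
  show "AE x in M. norm (flux s (comb (c k)) v x) \<le> 1 + R powr p * envelope x powr p + norm (grad \<Omega> v x) powr p" for k
    using all
  proof eventually_elim
    case (elim x)
    then show ?case
      using norm_powr_inner_bound[OF s, of "gcomb (c k) x" "grad \<Omega> v x"] norm_gcomb_powr_le[of "c k" R x, OF R]
      by (simp add: flux_def)
  qed
qed (intro flux_measurable comb_in_W v)+

lemma integral_flux_comb:
  assumes u: "u \<in> W" and s: "1 < s" "s \<le> p"
  shows "(LINT x|M. flux s u (comb d) x) = (\<Sum>j<n. d j * (LINT x|M. flux s u (b j) x))"
proof -
  have int: "integrable M (\<lambda>x. d j * flux s u (b j) x)" if "j < n" for j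
    using flux_integrable[OF u b_W[OF that] s] by simp
  have "(LINT x|M. flux s u (comb d) x) = (LINT x|M. (\<Sum>j<n. d j * flux s u (b j) x))"
  proof (rule integral_cong_AE)
    show "AE x in M. flux s u (comb d) x = (\<Sum>j<n. d j * flux s u (b j) x)"
      using grad_comb[of d]
      by eventually_elim (simp add: flux_def gcomb_def inner_sum_right sum_distrib_left mult.left_commute)
    show "(\<lambda>x. \<Sum>j<n. d j * flux s u (b j) x) \<in> borel_measurable M"
      by (intro borel_measurable_sum borel_measurable_times borel_measurable_const flux_measurable u b_W) auto
  qed (intro flux_measurable u comb_in_W)
  also have "\<dots> = (\<Sum>j<n. (LINT x|M. d j * flux s u (b j) x))"
    using int by (intro Bochner_Integration.integral_sum) auto
  finally show ?thesis
    by simp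
qed

lemma integral_reaction_comb:
  assumes u: "u \<in> W"
  shows "(LINT x|M. reaction u x * comb d x) = (\<Sum>j<n. d j * (LINT x|M. reaction u x * b j x))"
proof -
  have int: "integrable M (\<lambda>x. d j * (reaction u x * b j x))" if "j < n" for j
    using reaction_estimate(1)[OF u b_W[OF that]] by simp
  have "(LINT x|M. reaction u x * comb d x) = (LINT x|M. (\<Sum>j<n. d j * (reaction u x * b j x)))"
    by (simp add: comb_def sum_distrib_left mult.left_commute)
  also have "\<dots> = (\<Sum>j<n. (LINT x|M. d j * (reaction u x * b j x)))"
    using int by (intro Bochner_Integration.integral_sum) auto
  finally show ?thesis
    by simp
qed

section \<open>Residuals of the Galerkin equations\<close>

definition residual :: "(nat \<Rightarrow> real) \<Rightarrow> nat \<Rightarrow> real" where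
  "residual c j = (LINT x|M. flux p (comb c) (b j) x) - (LINT x|M. flux q (comb c) (b j) x)
    - (LINT x|M. reaction (comb c) x * b j x)"

text \<open>The residual is linear in the test function. With d = c the sum is the quantity in
  \<open>coercive\<close>; with arbitrary d it extends the n equations for the basis to all
  combinations.\<close>

lemma residual_sum:
  "(\<Sum>j<n. d j * residual c j) = (LINT x|M. flux p (comb c) (comb d) x)
    - (LINT x|M. flux q (comb c) (comb d) x) - (LINT x|M. reaction (comb c) x * comb d x)"
  using exponents
  by (simp add: residual_def integral_flux_comb[OF comb_in_W] integral_reaction_comb[OF comb_in_W]
      right_diff_distrib sum_subtractf)

lemma coord_cube_tendsto:
  assumes "\<And>k. c k \<in> coord_cube n R" "d \<in> coord_cube n R" "c \<longlonglongrightarrow> d"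
  shows "\<And>i. i < n \<Longrightarrow> (\<lambda>k. c k i) \<longlonglongrightarrow> d i" "\<And>k i. i < n \<Longrightarrow> \<bar>c k i\<bar> \<le> R"
    "\<And>i. i < n \<Longrightarrow> \<bar>d i\<bar> \<le> R"
  using assms by (auto simp: coord_cube_def tendsto_fun_iff)

lemma continuous_nrm_comb:
  assumes R: "0 \<le> R"
  shows "continuous_on (coord_cube n R) (\<lambda>c. nrm (comb c))"
  unfolding continuous_on_sequentially o_def
proof (intro ballI allI impI)
  fix c :: "nat \<Rightarrow> nat \<Rightarrow> real" and d assume d: "d \<in> coord_cube n R"
    and "(\<forall>k. c k \<in> coord_cube n R) \<and> c \<longlonglongrightarrow> d"
  then have c: "\<And>k. c k \<in> coord_cube n R" "c \<longlonglongrightarrow> d"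
    by auto
  show "(\<lambda>k. nrm (comb (c k))) \<longlonglongrightarrow> nrm (comb d)"
    by (rule nrm_comb_tendsto[OF coord_cube_tendsto(1,2)[OF c(1) d c(2)] R])
qed

lemma continuous_residual:
  assumes R: "0 \<le> R" and j: "j < n"
  shows "continuous_on (coord_cube n R) (\<lambda>c. residual c j)"
  unfolding continuous_on_sequentially o_def
proof (intro ballI allI impI)
  fix c :: "nat \<Rightarrow> nat \<Rightarrow> real" and d assume d: "d \<in> coord_cube n R"
    and "(\<forall>k. c k \<in> coord_cube n R) \<and> c \<longlonglongrightarrow> d"
  then have c: "\<And>k. c k \<in> coord_cube n R" "c \<longlonglongrightarrow> d"
    by auto
  note lim = coord_cube_tendsto[OF c(1) d c(2)]
  have "(\<lambda>k. nrm (comb (c k))) \<longlonglongrightarrow> nrm (comb d)"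
    by (rule nrm_comb_tendsto[OF lim(1,2) R])
  \<comment> \<open>\<open>reaction_continuous\<close> asks for a common bound on the norms, because
    the bounds on T grow with the norm of its argument.\<close>
  then have "bounded (range (\<lambda>k. nrm (comb (c k))))"
    by (rule convergent_imp_bounded)
  then obtain B where B: "\<And>k. nrm (comb (c k)) \<le> B"
    unfolding bounded_iff by (auto simp: image_iff)
  have "(\<lambda>k. LINT x|M. reaction (comb (c k)) x * b j x) \<longlonglongrightarrow> (LINT x|M. reaction (comb d) x * b j x)"
    by (rule reaction_continuous[OF comb_in_W comb_in_W b_W[OF j] nrm_comb_diff_tendsto[OF lim(1,2) R lim(3)] B])
  then show "(\<lambda>k. residual (c k) j) \<longlonglongrightarrow> residual d j"
    unfolding residual_def using exponents
    by (intro tendsto_diff flux_tendsto[OF lim(1,2) R b_W[OF j]]) auto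
qed

lemma nrm_comb_scale: "0 \<le> t \<Longrightarrow> nrm (comb (\<lambda>i. t * c i)) = t * nrm (comb c)"
proof -
  assume t: "0 \<le> t"
  have "gcomb (\<lambda>i. t * c i) x = t *\<^sub>R gcomb c x" for x
    by (simp add: gcomb_def scaleR_sum_right)
  then show ?thesis
    using t exponent_ranges(1) unfolding nrm_comb by (simp add: lp_norm_def powr_mult powr_powr)
qed

text \<open>On the boundary of the unit cube some coefficient is nonzero, so the norm is positive
  there by independence. The boundary is compact and the norm continuous, hence its minimum is
  attained and positive.\<close>

lemma nrm_comb_bounded_below:
  assumes n: "0 < n"
  shows "\<exists>m>0. \<forall>c\<in>coord_cube n 1. \<forall>i<n. \<bar>c i\<bar> = 1 \<longrightarrow> m \<le> nrm (comb c)"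
proof -
  let ?Z = "coord_cube n 1 \<inter> (\<Union>i<n. (\<lambda>c. c i) -` {-1, 1})"
  have "closed ((\<lambda>c :: nat \<Rightarrow> real. c i) -` {-1, 1})" for i
    by (intro closed_vimage closed_insert closed_empty continuous_on_product_coordinates)
  then have Z: "compact ?Z"
    by (intro compact_Int_closed compact_coord_cube closed_UN) auto
  have "(\<lambda>i. if i = 0 then 1 else 0) \<in> ?Z"
    using n by (auto simp: coord_cube_def intro!: bexI[of _ 0])
  then have "?Z \<noteq> {}"
    by blast
  moreover have "continuous_on ?Z (\<lambda>c. nrm (comb c))"
    by (rule continuous_on_subset[OF continuous_nrm_comb[of 1]]) auto
  ultimately obtain z where z: "z \<in> ?Z" "\<And>c. c \<in> ?Z \<Longrightarrow> nrm (comb z) \<le> nrm (comb c)"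
    using continuous_attains_inf[OF Z] by blast
  from z(1) obtain i where "i < n" "z i \<noteq> 0"
    by auto
  then have "0 < nrm (comb z)"
    by (rule nrm_comb_pos)
  moreover have "nrm (comb z) \<le> nrm (comb c)" if "c \<in> coord_cube n 1" "i < n" "\<bar>c i\<bar> = 1" for c i
    using that by (intro z(2)) (auto simp: abs_if split: if_splits)
  ultimately show ?thesis
    by blast
qed

lemma residual_zero: "\<exists>c. \<forall>j<n. residual c j = 0"
proof (cases "0 < n")
  case True
  obtain m where m: "0 < m" "\<And>c i. c \<in> coord_cube n 1 \<Longrightarrow> i < n \<Longrightarrow> \<bar>c i\<bar> = 1 \<Longrightarrow> m \<le> nrm (comb c)"
    using nrm_comb_bounded_below[OF True] by blast
  obtain t0 where t0: "0 < t0" "\<And>u. u \<in> W \<Longrightarrow> t0 \<le> nrm u \<Longrightarrow>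
    0 < (LINT x|M. flux p u u x) - (LINT x|M. flux q u u x) - (LINT x|M. reaction u x * u x)"
    using coercive by blast
  \<comment> \<open>By scaling, the norm is at least R m = t0 on the whole boundary of the cube of
    half-width R, which is where \<open>coercive\<close> applies.\<close>
  define R where "R = t0 / m"
  have R: "0 < R" "R * m = t0"
    using t0 m by (auto simp: R_def)
  have "\<exists>c\<in>coord_cube n R. \<forall>j<n. residual c j = 0"
  proof (rule coercive_zero_in_cube[OF R(1)])
    show "continuous_on (coord_cube n R) (\<lambda>c. residual c i)" if "i < n" for i
      using R(1) that by (intro continuous_residual) auto
    fix c i assume c: "c \<in> coord_cube n R" and i: "i < n" "\<bar>c i\<bar> = R"
    define e where "e = (\<lambda>i. c i / R)"
    have ce: "c = (\<lambda>i. R * e i)"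
      using R by (simp add: e_def)
    have "e \<in> coord_cube n 1" "\<bar>e i\<bar> = 1"
      using c i R(1) by (auto simp: e_def coord_cube_def abs_divide divide_le_eq)
    then have "m \<le> nrm (comb e)"
      using m(2) i(1) by blast
    then have "R * m \<le> R * nrm (comb e)"
      using R(1) by (intro mult_left_mono) auto
    also have "\<dots> = nrm (comb c)"
      using R(1) nrm_comb_scale[of R e] by (simp flip: ce)
    finally have "t0 \<le> nrm (comb c)"
      using R(2) by simp
    from t0(2)[OF comb_in_W this] show "0 < (\<Sum>i<n. c i * residual c i)"
      by (simp add: residual_sum)
  qed
  then show ?thesis
    by blast
qed simp

end

section \<open>Existence of Galerkin solutions\<close>

lemma function_subspace_sum:
  assumes X: "function_subspace X" and b: "\<And>i. i < n \<Longrightarrow> b i \<in> X"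
  shows "(\<lambda>x. \<Sum>i<n::nat. c i * b i x) \<in> X"
  using b
proof (induction n)
  case 0
  then show ?case
    using X by (simp add: function_subspace_def)
next
  case (Suc n)
  have add: "\<forall>u\<in>X. \<forall>v\<in>X. (\<lambda>x. u x + v x) \<in> X"
    using X by (simp add: function_subspace_def)
  have "(\<lambda>x. \<Sum>i<n. c i * b i x) \<in> X" "(\<lambda>x. c n * b n x) \<in> X"
    using Suc X by (auto simp: function_subspace_def)
  from bspec[OF bspec[OF add this(1)] this(2)] show ?case
    by simp
qed

text \<open>A spanning set of least cardinality is independent modulo null sets, since a nontrivial
  relation would allow one element to be removed. This also excludes two distinct elements that
  agree almost everywhere.\<close>

lemma finite_dimensional_ae_basis:
  assumes "finite_dimensional_ae \<Omega> X"
  obtains b :: "nat \<Rightarrow> 'a::euclidean_space \<Rightarrow> real" and n where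
    "\<And>i. i < n \<Longrightarrow> b i \<in> X"
    "\<And>u. u \<in> X \<Longrightarrow> \<exists>c. AE x in lebesgue_on \<Omega>. u x = (\<Sum>i<n. c i * b i x)"
    "\<And>c i. \<lbrakk>AE x in lebesgue_on \<Omega>. (\<Sum>i<n. c i * b i x) = 0; i < n\<rbrakk> \<Longrightarrow> c i = 0"
proof -
  define spans where "spans B \<longleftrightarrow> finite B \<and> B \<subseteq> X \<and>
    (\<forall>u\<in>X. \<exists>c. AE x in lebesgue_on \<Omega>. u x = (\<Sum>\<beta>\<in>B. c \<beta> * \<beta> x))" for B
  obtain B where B: "spans B" and min: "\<And>B'. spans B' \<Longrightarrow> card B \<le> card B'"
  proof -
    obtain B0 where "spans B0"
      using assms unfolding finite_dimensional_ae_def spans_def by blast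
    from ex_has_least_nat[of spans, OF this, of card] show thesis
      using that by blast
  qed
  have fin: "finite B" and BX: "B \<subseteq> X"
    and span: "\<And>u. u \<in> X \<Longrightarrow> \<exists>c. AE x in lebesgue_on \<Omega>. u x = (\<Sum>\<beta>\<in>B. c \<beta> * \<beta> x)"
    using B by (auto simp: spans_def)
  have indep: "C \<beta>0 = 0"
    if zero: "AE x in lebesgue_on \<Omega>. (\<Sum>\<beta>\<in>B. C \<beta> * \<beta> x) = 0" and \<beta>0: "\<beta>0 \<in> B" for C \<beta>0
  proof (rule ccontr)
    assume nz: "C \<beta>0 \<noteq> 0"
    have "spans (B - {\<beta>0})"
      unfolding spans_def
    proof (intro conjI ballI)
      fix u assume "u \<in> X"
      then obtain d where d: "AE x in lebesgue_on \<Omega>. u x = (\<Sum>\<beta>\<in>B. d \<beta> * \<beta> x)"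
        using span by blast
      \<comment> \<open>Subtracting the multiple \<open>d \<beta>0 / C \<beta>0\<close> of the
        relation makes the coefficient of \<beta>0 vanish.\<close>
      let ?e = "\<lambda>\<beta>. d \<beta> - d \<beta>0 / C \<beta>0 * C \<beta>"
      have "AE x in lebesgue_on \<Omega>. u x = (\<Sum>\<beta>\<in>B - {\<beta>0}. ?e \<beta> * \<beta> x)"
        using d zero
      proof eventually_elim
        case (elim x)
        have "u x = (\<Sum>\<beta>\<in>B. d \<beta> * \<beta> x) - d \<beta>0 / C \<beta>0 * (\<Sum>\<beta>\<in>B. C \<beta> * \<beta> x)"
          using elim by simp
        also have "\<dots> = (\<Sum>\<beta>\<in>B. ?e \<beta> * \<beta> x)"
          by (simp add: sum_distrib_left left_diff_distrib sum_subtractf mult.assoc)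
        also have "\<dots> = ?e \<beta>0 * \<beta>0 x + (\<Sum>\<beta>\<in>B - {\<beta>0}. ?e \<beta> * \<beta> x)"
          by (rule sum.remove[OF fin \<beta>0])
        also have "?e \<beta>0 = 0"
          using nz by simp
        finally show ?case
          by simp
      qed
      then show "\<exists>c. AE x in lebesgue_on \<Omega>. u x = (\<Sum>\<beta>\<in>B - {\<beta>0}. c \<beta> * \<beta> x)"
        by (rule exI[of _ ?e])
    qed (use fin BX in auto)
    from min[OF this] show False
      using card_Diff1_less[OF fin \<beta>0] by simp
  qed
  obtain b where b: "bij_betw b {..<card B} B"
    using ex_bij_betw_nat_finite[OF fin] by (auto simp: lessThan_atLeast0)
  have reindex: "(\<Sum>\<beta>\<in>B. c \<beta> * \<beta> x) = (\<Sum>i<card B. c (b i) * b i x)" for c x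
    by (rule sum.reindex_bij_betw[OF b, symmetric])
  show thesis
  proof (rule that[of "card B" b])
    show "b i \<in> X" if "i < card B" for i
      using bij_betw_apply[OF b] that BX by auto
    show "\<exists>c. AE x in lebesgue_on \<Omega>. u x = (\<Sum>i<card B. c i * b i x)" if u: "u \<in> X" for u
    proof -
      obtain c where "AE x in lebesgue_on \<Omega>. u x = (\<Sum>\<beta>\<in>B. c \<beta> * \<beta> x)"
        using span[OF u] by blast
      then show ?thesis
        unfolding reindex by (intro exI[of _ "\<lambda>i. c (b i)"])
    qed
    fix c i assume zero: "AE x in lebesgue_on \<Omega>. (\<Sum>i<card B. c i * b i x) = 0" and i: "i < card B"
    \<comment> \<open>Coefficients indexed by numbers are carried over to the elements of B through
      the inverse of the enumeration b.\<close>
    let ?C = "\<lambda>\<beta>. c (inv_into {..<card B} b \<beta>)"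
    have inv: "inv_into {..<card B} b (b j) = j" if "j < card B" for j
      using b that by (intro inv_into_f_f) (auto simp: bij_betw_def)
    have "(\<Sum>\<beta>\<in>B. ?C \<beta> * \<beta> x) = (\<Sum>i<card B. c i * b i x)" for x
      unfolding reindex by (intro sum.cong) (auto simp: inv)
    then have "?C (b i) = 0"
      using zero bij_betw_apply[OF b] i by (intro indep) auto
    then show "c i = 0"
      by (simp add: inv i)
  qed
qed

text \<open>Integrability is asserted along with the equation, because a non-integrable reaction
  term would have integral 0 by convention.\<close>

lemma (in convective_problem) galerkin_solution:
  assumes X: "X \<subseteq> W" "function_subspace X" "finite_dimensional_ae \<Omega> X"
  shows "\<exists>u\<in>X. \<forall>v\<in>X. integrable M (\<lambda>x. reaction u x * v x) \<and>
      - laplacian_pairing \<Omega> p u v + laplacian_pairing \<Omega> q u v = (LINT x|M. reaction u x * v x)"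
proof -
  obtain b :: "nat \<Rightarrow> 'a \<Rightarrow> real" and n where
    bX: "\<And>i. i < n \<Longrightarrow> b i \<in> X"
    and span: "\<And>u. u \<in> X \<Longrightarrow> \<exists>c. AE x in M. u x = (\<Sum>i<n. c i * b i x)"
    and indep: "\<And>c i. \<lbrakk>AE x in M. (\<Sum>i<n. c i * b i x) = 0; i < n\<rbrakk> \<Longrightarrow> c i = 0"
    by (rule finite_dimensional_ae_basis[OF X(3)]) (rule that)
  have combX: "(\<lambda>x. \<Sum>i<n. c i * b i x) \<in> X" for c
    by (rule function_subspace_sum[OF X(2) bX])
  interpret convective_galerkin \<Omega> p q r \<alpha> \<beta> a1 a2 K1 K2 K3 pstar S T f \<sigma> b n
  proof unfold_locales
    fix c :: "nat \<Rightarrow> real" and i assume i: "i < n" "c i \<noteq> 0"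
    let ?u = "\<lambda>x. \<Sum>i<n. c i * b i x"
    have u: "?u \<in> W"
      using combX X(1) by blast
    \<comment> \<open>The embedding at exponent p is a Poincare inequality: a vanishing gradient
      norm forces the combination to vanish almost everywhere, against the independence of the
      basis.\<close>
    have p: "p \<in> {1..pstar}"
      using exponents by auto
    show "nrm ?u \<noteq> 0"
    proof
      assume "nrm ?u = 0"
      then have "lp_norm M p ?u = 0"
        using Sobolev_embedding(2)[OF u p] lp_norm_nonneg[of M p ?u] by simp
      then have "AE x in M. ?u x = 0"
        using lp_norm_eq_0_iff_AE[OF Sobolev_embedding(1)[OF u p]] by simp
      with indep i show False
        by blast
    qed
  qed (use combX bX X(1) in blast)+
  obtain c where c: "\<And>j. j < n \<Longrightarrow> residual c j = 0"
    using residual_zero by blast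
  let ?u = "comb c"
  show ?thesis
  proof (intro bexI[of _ ?u] ballI conjI)
    show "?u \<in> X"
      using combX by (simp add: comb_def[abs_def])
    fix v assume v: "v \<in> X"
    then have vW: "v \<in> W"
      using X(1) by blast
    show int: "integrable M (\<lambda>x. reaction ?u x * v x)"
      by (rule reaction_estimate(1)[OF comb_in_W vW])
    \<comment> \<open>v is a combination of the basis only almost everywhere, but then
      \<open>grad_cong_AE\<close> makes the two chosen gradients identical, and the flux integrals
      coincide.\<close>
    obtain d where d: "AE x in M. v x = comb d x"
      using span[OF v] by (auto simp: comb_def)
    then have grad: "grad \<Omega> v = grad \<Omega> (comb d)"
      by (rule grad_cong_AE[OF open_domain])
    have "AE x in M. reaction ?u x * v x = reaction ?u x * comb d x"
      using d by eventually_elim simp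
    then have "(LINT x|M. reaction ?u x * v x) = (LINT x|M. reaction ?u x * comb d x)"
      using reaction_measurable[OF comb_in_W] W_D(2)[OF vW] W_D(2)[OF comb_in_W]
      by (intro integral_cong_AE borel_measurable_times) auto
    moreover have "laplacian_pairing \<Omega> s ?u v = - (LINT x|M. flux s ?u (comb d) x)" for s
      by (simp add: laplacian_pairing_def flux_def grad)
    moreover have "(\<Sum>j<n. d j * residual c j) = 0"
      using c by simp
    ultimately show "- laplacian_pairing \<Omega> p ?u v + laplacian_pairing \<Omega> q ?u v = (LINT x|M. reaction ?u x * v x)"
      unfolding residual_sum by simp
  qed
qed

theorem proposition1:
  fixes \<Omega> :: "(real ^ 'n) set"
    and p q r \<alpha> \<beta> a1 a2 K1 K2 K3 pstar :: real
    and S :: "real \<Rightarrow> real"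
    and T :: "(real ^ 'n \<Rightarrow> real) \<Rightarrow> (real ^ 'n \<Rightarrow> real)"
    and f :: "real ^ 'n \<Rightarrow> real \<Rightarrow> real ^ 'n \<Rightarrow> real"
    and X :: "nat \<Rightarrow> (real ^ 'n \<Rightarrow> real) set"
    and \<sigma> :: "real ^ 'n \<Rightarrow> real"
  assumes domain: "bounded_domain \<Omega>" "lipschitz_boundary \<Omega>"
    and exponents: "1 < q" "q < p" "p < real CARD('n)"
    and pstar: "pstar = real CARD('n) * p / (real CARD('n) - p)"
    and S: "sobolev_constants \<Omega> p pstar S"
    and T: "continuous_sobolev_map \<Omega> p T"
    and f: "caratheodory \<Omega> f"
    and X: "galerkin_basis \<Omega> p X"
    and a: "0 \<le> a1" "0 \<le> a2"
    and alpha: "0 < \<alpha>" "\<alpha> < pstar - 1"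
    and beta: "0 < \<beta>" "ereal \<beta> < ereal p / conj_exponent pstar"
    and r: "1 \<le> r" "r < pstar"
    and sigma: "\<sigma> \<in> Lspace \<Omega> (conj_exponent r)"
    and growth: "AE x in lebesgue_on \<Omega>. \<forall>s \<xi>.
        \<bar>f x s \<xi>\<bar> \<le> \<sigma> x + a1 * \<bar>s\<bar> powr \<alpha> + a2 * norm \<xi> powr \<beta>"
    and K: "0 \<le> K1" "0 \<le> K2" "0 \<le> K3"
    and small: "a1 * K1 * S (pstar / (pstar - \<alpha>)) + a2 * K2 * S (p / (p - \<beta>)) < 1"
    and T_bound: "\<forall>u\<in>sobolev0 \<Omega> p.
        epowr (Lnorm \<Omega> pstar (T u)) \<alpha>
          \<le> ennreal K1 * epowr (Lnorm \<Omega> p (grad \<Omega> u)) (p - 1) + ennreal K3"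
    and grad_T_bound: "\<forall>u\<in>sobolev0 \<Omega> p.
        epowr (Lnorm \<Omega> p (grad \<Omega> (T u))) \<beta>
          \<le> ennreal K2 * epowr (Lnorm \<Omega> p (grad \<Omega> u)) (p - 1) + ennreal K3"
  shows "\<forall>n. \<exists>u\<in>X n. \<forall>v\<in>X n.
      integrable (lebesgue_on \<Omega>) (\<lambda>x. f x (T u x) (grad \<Omega> (T u) x) * v x) \<and>
      - laplacian_pairing \<Omega> p u v + laplacian_pairing \<Omega> q u v
        = (LINT x|lebesgue_on \<Omega>. f x (T u x) (grad \<Omega> (T u) x) * v x)"
proof
  fix n
  \<comment> \<open>\<open>p < pstar\<close> because the factor N/(N - p) exceeds 1.\<close>
  have "p * (real CARD('n) - p) < real CARD('n) * p"
    using exponents by (simp add: algebra_simps)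
  then have p_less: "p < pstar"
    using exponents unfolding pstar by (simp add: less_divide_eq)
  \<comment> \<open>The conjugate exponent of \<open>pstar\<close> is pstar/(pstar - 1), which is
    finite since \<open>pstar\<close> exceeds 1; this yields the form of the bound on \<beta> in the
    locale.\<close>
  have "p / (pstar / (pstar - 1)) = p - p / pstar"
    using p_less exponents by (simp add: field_simps)
  then have beta': "\<beta> < p - p / pstar"
    using beta(2) p_less exponents by (simp add: conj_exponent_def)
  have "open \<Omega>" "bounded \<Omega>"
    using domain(1) by (simp_all add: bounded_domain_def)
  interpret convective_problem \<Omega> p q r \<alpha> \<beta> a1 a2 K1 K2 K3 pstar S T f \<sigma>
    by unfold_locales (fact | erule bspec[OF T_bound] | erule bspec[OF grad_T_bound])+
  have "X n \<subseteq> sobolev0 \<Omega> p" "function_subspace (X n)" "finite_dimensional_ae \<Omega> (X n)"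
    using X by (auto simp: galerkin_basis_def)
  from galerkin_solution[OF this] show "\<exists>u\<in>X n. \<forall>v\<in>X n.
      integrable (lebesgue_on \<Omega>) (\<lambda>x. f x (T u x) (grad \<Omega> (T u) x) * v x) \<and>
      - laplacian_pairing \<Omega> p u v + laplacian_pairing \<Omega> q u v
        = (LINT x|lebesgue_on \<Omega>. f x (T u x) (grad \<Omega> (T u) x) * v x)"
    by (simp add: reaction_def)
qed

end
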